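(* Let $A$ be a weak bialgebra. Then the following are equivalent: (a) $A$ is comonoidal; (b) $A$ is left-comonoidal and $[A_L,A_R]=0$; (c) $A$ is right-comonoidal and $[A_L,A_R]=0$. In this case one also has $A_L\cap A_R\cong C_L(\hat A)\cong C_R(\hat A)$ (as algebras), and $C_L(A)=C(A)\cap A_L$, $C_R(A)=C(A)\cap A_R$.
   Context: $K$ is a field and all spaces are finite dimensional over $K$. A weak bialgebra $(A,1,\Delta,\varepsilon)$ is a unital associative $K$-algebra $(A,1)$ which is also a coassociative coalgebra with coproduct $\Delta$ and counit $\varepsilon$, such that $\Delta(ab)=\Delta(a)\Delta(b)$ for all $a,b$; neither $\Delta(1)=1\otimes1$ nor multiplicativity of $\varepsilon$ is required. Sweedler notation is used. The dual $\hat A=\mathrm{Hom}_K(A,K)$ is a weak bialgebra with the transposed structure: product $\langle\phi\psi\mid a\rangle=\langle\phi\otimes\psi\mid\Delta(a)\rangle$, unit $\varepsilon$, coproduct $\langle\hat\Delta(\phi)\mid a\otimes b\rangle=\langle\phi\mid ab\rangle$, counit $\phi\mapsto\langle\phi\mid1\rangle$. $A$ is left-comonoidal if $(\Delta(1)\otimes1)(1\otimes\Delta(1))=1_{(1)}\otimes1_{(2)}\otimes1_{(3)}$, right-comonoidal if $(1\otimes\Delta(1))(\Delta(1)\otimes1)=1_{(1)}\otimes1_{(2)}\otimes1_{(3)}$, and comonoidal if both hold. $A_L=\{\langle\phi\mid1_{(1)}\rangle1_{(2)}:\phi\in\hat A\}$, $A_R=\{1_{(1)}\langle\phi\mid1_{(2)}\rangle:\phi\in\hat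 A\}$. $[A_L,A_R]=0$ means that these subspaces commute elementwise. $C(A)$ is the center of the algebra $A$. For a weak bialgebra $B$ (either $A$ or $\hat A$) with unit $1$ put $N_{LL}(B)=\{b:\Delta(b)=b1_{(1)}\otimes1_{(2)}\}$, $N_{LR}(B)=\{b:\Delta(b)=1_{(1)}b\otimes1_{(2)}\}$, $N_{RL}(B)=\{b:\Delta(b)=1_{(1)}\otimes b1_{(2)}\}$, $N_{RR}(B)=\{b:\Delta(b)=1_{(1)}\otimes1_{(2)}b\}$. For $\sigma\in\{L,R\}$ one has $N_{\sigma L}(B)\cap C(B)=N_{\sigma R}(B)\cap C(B)$, and this algebra is denoted $C_\sigma(B)$. *)

theory Defs
  imports Complex_Main "HOL-Library.Function_Algebras"
begin

text \<open>
  Spaces have an explicit carrier inside an ambient vector space, because the dual of a space has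
  to be a structure of the same kind again. Addition is that of the ambient type.
\<close>

record ('k, 'a) kspace =
  carrier :: "'a set"
  smul :: "'k \<Rightarrow> 'a \<Rightarrow> 'a" (infixr "\<bullet>\<index>" 75)

locale fd_space =
  fixes A :: "('k::field, 'a::ab_group_add, 'z) kspace_scheme" (structure)
  assumes ambient: "vector_space (smul A)"
    and finite_span: "\<exists>B. finite B \<and> module.span (smul A) B = carrier A"

text \<open>\<open>Hom\<^sub>K(A, K)\<close>; a functional is extended by \<open>0\<close> outside the carrier, so that equality of
  functionals is equality on the carrier.\<close>

definition dual_set :: "('k::field, 'a::ab_group_add, 'z) kspace_scheme \<Rightarrow> ('a \<Rightarrow> 'k) set" where
  "dual_set A = {\<phi>. (\<forall>x\<in>carrier A. \<forall>y\<in>carrier A. \<phi> (x + y) = \<phi> x + \<phi> y)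
     \<and> (\<forall>c. \<forall>x\<in>carrier A. \<phi> (c \<bullet>\<^bsub>A\<^esub> x) = c * \<phi> x)
     \<and> (\<forall>x. x \<notin> carrier A \<longrightarrow> \<phi> x = 0)}"

definition dual_space :: "('k::field, 'a::ab_group_add, 'z) kspace_scheme \<Rightarrow> ('k, 'a \<Rightarrow> 'k) kspace" where
  "dual_space A = \<lparr>carrier = dual_set A, smul = (\<lambda>c \<phi> x. c * \<phi> x)\<rparr>"

text \<open>
  A tensor \<open>t\<close> in \<open>A \<otimes> A\<close> is represented by the function that sends two functionals
  \<open>\<phi>\<close>, \<open>\<psi>\<close> on \<open>A\<close> to the scalar \<open>\<langle>\<phi> \<otimes> \<psi> | t\<rangle>\<close>, and \<open>A \<otimes> A\<close> is the set of all sums of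
  elementary tensors; similarly for \<open>A \<otimes> A \<otimes> A\<close>. Since functionals separate points, this is the
  usual tensor product: see the universal properties \<open>sweedler2_eq\<close> and \<open>sweedler3_eq\<close> below.
\<close>

type_synonym ('k, 'a) tensor2 = "('a \<Rightarrow> 'k) \<Rightarrow> ('a \<Rightarrow> 'k) \<Rightarrow> 'k"
type_synonym ('k, 'a) tensor3 = "('a \<Rightarrow> 'k) \<Rightarrow> ('a \<Rightarrow> 'k) \<Rightarrow> ('a \<Rightarrow> 'k) \<Rightarrow> 'k"

definition elem2 :: "('k::field, 'a::ab_group_add, 'z) kspace_scheme \<Rightarrow> 'a \<Rightarrow> 'a \<Rightarrow> ('k, 'a) tensor2"
    ("_ \<otimes>\<index> _" [76, 76] 75) where
  "elem2 A x y = (\<lambda>\<phi> \<psi>. if \<phi> \<in> dual_set A \<and> \<psi> \<in> dual_set A then \<phi> x * \<psi> y else 0)"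

definition elem3 :: "('k::field, 'a::ab_group_add, 'z) kspace_scheme \<Rightarrow> 'a \<Rightarrow> 'a \<Rightarrow> 'a \<Rightarrow> ('k, 'a) tensor3"
    ("_ \<otimes>\<index> _ \<otimes> _" [76, 76, 76] 75) where
  "elem3 A x y z = (\<lambda>\<phi> \<psi> \<chi>.
     if \<phi> \<in> dual_set A \<and> \<psi> \<in> dual_set A \<and> \<chi> \<in> dual_set A then \<phi> x * \<psi> y * \<chi> z else 0)"

definition tensors2 :: "('k::field, 'a::ab_group_add, 'z) kspace_scheme \<Rightarrow> ('k, 'a) tensor2 set" where
  "tensors2 A = {\<Sum>(x, y)\<leftarrow>xs. x \<otimes>\<^bsub>A\<^esub> y | xs. set xs \<subseteq> carrier A \<times> carrier A}"

definition tensors3 :: "('k::field, 'a::ab_group_add, 'z) kspace_scheme \<Rightarrow> ('k, 'a) tensor3 set" where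
  "tensors3 A = {\<Sum>(x, y, z)\<leftarrow>xs. x \<otimes>\<^bsub>A\<^esub> y \<otimes> z | xs. set xs \<subseteq> carrier A \<times> carrier A \<times> carrier A}"

text \<open>
  Sweedler notation: if \<open>t = \<Sum>\<^sub>i x\<^sub>i \<otimes> y\<^sub>i\<close> then \<open>sweedler2 A t f = \<Sum>\<^sub>i f x\<^sub>i y\<^sub>i\<close>, which for bilinear
  \<open>f\<close> does not depend on the chosen presentation of \<open>t\<close>.
\<close>

definition sweedler2 :: "('k::field, 'a::ab_group_add, 'z) kspace_scheme \<Rightarrow> ('k, 'a) tensor2 \<Rightarrow>
    ('a \<Rightarrow> 'a \<Rightarrow> 'c::ab_group_add) \<Rightarrow> 'c" where
  "sweedler2 A t f = (\<Sum>(x, y)\<leftarrow>(SOME xs. set xs \<subseteq> carrier A \<times> carrier A \<and>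
      (\<Sum>(x, y)\<leftarrow>xs. x \<otimes>\<^bsub>A\<^esub> y) = t). f x y)"

definition sweedler3 :: "('k::field, 'a::ab_group_add, 'z) kspace_scheme \<Rightarrow> ('k, 'a) tensor3 \<Rightarrow>
    ('a \<Rightarrow> 'a \<Rightarrow> 'a \<Rightarrow> 'c::ab_group_add) \<Rightarrow> 'c" where
  "sweedler3 A t f = (\<Sum>(x, y, z)\<leftarrow>(SOME xs. set xs \<subseteq> carrier A \<times> carrier A \<times> carrier A \<and>
      (\<Sum>(x, y, z)\<leftarrow>xs. x \<otimes>\<^bsub>A\<^esub> y \<otimes> z) = t). f x y z)"

lemma sum_list_fun_apply: "(\<Sum>x\<leftarrow>xs. g x) \<phi> = (\<Sum>x\<leftarrow>xs. g x \<phi>)"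
  for g :: "'a \<Rightarrow> 'b \<Rightarrow> 'c::comm_monoid_add"
  by (induction xs) auto

lemma sum_fun_apply: "(\<Sum>x\<in>S. g x) \<phi> = (\<Sum>x\<in>S. g x \<phi>)"
  for g :: "'a \<Rightarrow> 'b \<Rightarrow> 'c::comm_monoid_add"
  by (induction S rule: infinite_finite_induct) auto

context fd_space
begin

sublocale vector_space "smul A" by (rule ambient)

lemma subspace_carrier: "subspace (carrier A)"
  using finite_span subspace_span by metis

lemma dual_basis:
  obtains B r where "finite B" "B \<subseteq> carrier A" "\<And>b. b \<in> B \<Longrightarrow> r b \<in> dual_set A"
    "\<And>x. x \<in> carrier A \<Longrightarrow> x = (\<Sum>b\<in>B. r b x \<bullet> b)"
proof -
  obtain S where S: "finite S" "span S = carrier A" using finite_span by auto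
  obtain B where B: "B \<subseteq> carrier A" "independent B" "carrier A \<subseteq> span B"
    using basis_exists by metis
  have fin: "finite B" using independent_span_bound[OF S(1) B(2)] B(1) S(2) by auto
  have sp: "span B = carrier A"
    using B(1,3) span_minimal[OF B(1) subspace_carrier] by auto
  define r where "r b x = (if x \<in> carrier A then representation B x b else 0)" for b x
  have "r b \<in> dual_set A" for b
    unfolding dual_set_def r_def
    using B(2) sp subspace_add[OF subspace_carrier] subspace_scale[OF subspace_carrier]
    by (auto simp: representation_add representation_scale)
  moreover have "x = (\<Sum>b\<in>B. r b x \<bullet> b)" if "x \<in> carrier A" for x
    using sum_representation_eq[OF B(2), of x B] fin that sp by (simp add: r_def)
  ultimately show ?thesis using that fin B(1) by blast
qed

end

definition linear_map_on :: "('k::field, 'a::ab_group_add, 'z) kspace_scheme \<Rightarrow>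
    ('k \<Rightarrow> 'c \<Rightarrow> 'c) \<Rightarrow> ('a \<Rightarrow> 'c::ab_group_add) \<Rightarrow> bool" where
  "linear_map_on A s f \<longleftrightarrow> (\<forall>x\<in>carrier A. \<forall>y\<in>carrier A. f (x + y) = f x + f y)
    \<and> (\<forall>c. \<forall>x\<in>carrier A. f (c \<bullet>\<^bsub>A\<^esub> x) = s c (f x))"

context fd_space
begin

lemma linear_map_on_expand:
  assumes "linear_map_on A s f" "finite B" "B \<subseteq> carrier A"
    "\<And>x. x \<in> carrier A \<Longrightarrow> x = (\<Sum>b\<in>B. r b x \<bullet> b)" "x \<in> carrier A"
  shows "f x = (\<Sum>b\<in>B. s (r b x) (f b))"
proof -
  have 0: "f 0 = 0"
    using assms(1) subspace_0[OF subspace_carrier]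
    unfolding linear_map_on_def by (metis add_cancel_right_right)
  have "f (\<Sum>b\<in>S. r b x \<bullet> b) = (\<Sum>b\<in>S. s (r b x) (f b))" if "S \<subseteq> B" for S
    using finite_subset[OF that assms(2)] that
  proof (induction S rule: finite_induct)
    case empty
    show ?case by (simp add: 0)
  next
    case (insert b S)
    have "(\<Sum>b\<in>S. r b x \<bullet> b) \<in> carrier A" "r b x \<bullet> b \<in> carrier A"
      using insert.prems assms(3) subspace_carrier by (auto intro!: subspace_sum subspace_scale)
    then show ?case
      using assms(1) insert assms(3) unfolding linear_map_on_def by auto
  qed
  from this[of B] assms(4)[OF assms(5)] show ?thesis by simp
qed

lemma sum_list_bilinear_eq:
  assumes V: "vector_space s"
    and f: "\<And>y. y \<in> carrier A \<Longrightarrow> linear_map_on A s (\<lambda>x. f x y)"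
      "\<And>x. x \<in> carrier A \<Longrightarrow> linear_map_on A s (\<lambda>y. f x y)"
    and xs: "set xs \<subseteq> carrier A \<times> carrier A"
    and B: "finite B" "B \<subseteq> carrier A" "\<And>b. b \<in> B \<Longrightarrow> r b \<in> dual_set A"
      "\<And>x. x \<in> carrier A \<Longrightarrow> x = (\<Sum>b\<in>B. r b x \<bullet> b)"
  shows "(\<Sum>(x, y)\<leftarrow>xs. f x y) =
    (\<Sum>b\<in>B. \<Sum>c\<in>B. s ((\<Sum>(x, y)\<leftarrow>xs. x \<otimes> y) (r b) (r c)) (f b c))"
  using xs
proof (induction xs)
  interpret s: vector_space s by (rule V)
  case Nil
  show ?case by simp
next
  interpret s: vector_space s by (rule V)
  case (Cons p xs)
  obtain x y where p: "p = (x, y)" by force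
  have xy: "x \<in> carrier A" "y \<in> carrier A" using Cons.prems p by auto
  have "f x y = (\<Sum>b\<in>B. s (r b x) (f b y))"
    using linear_map_on_expand[OF f(1)[OF xy(2)] B(1,2,4) xy(1)] by simp
  also have "\<dots> = (\<Sum>b\<in>B. \<Sum>c\<in>B. s (r b x * r c y) (f b c))"
  proof (rule sum.cong[OF refl])
    fix b assume b: "b \<in> B"
    have "f b y = (\<Sum>c\<in>B. s (r c y) (f b c))"
      using linear_map_on_expand[OF f(2) B(1,2,4) xy(2)] b B(2) by blast
    then show "s (r b x) (f b y) = (\<Sum>c\<in>B. s (r b x * r c y) (f b c))"
      by (simp add: s.scale_sum_right)
  qed
  also have "\<dots> = (\<Sum>b\<in>B. \<Sum>c\<in>B. s ((x \<otimes> y) (r b) (r c)) (f b c))"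
    by (intro sum.cong refl) (simp add: elem2_def B(3))
  finally show ?case
    using Cons by (simp add: p s.scale_left_distrib sum.distrib)
qed

lemma sum_list_trilinear_eq:
  assumes V: "vector_space s"
    and f: "\<And>y z. y \<in> carrier A \<Longrightarrow> z \<in> carrier A \<Longrightarrow> linear_map_on A s (\<lambda>x. f x y z)"
      "\<And>x z. x \<in> carrier A \<Longrightarrow> z \<in> carrier A \<Longrightarrow> linear_map_on A s (\<lambda>y. f x y z)"
      "\<And>x y. x \<in> carrier A \<Longrightarrow> y \<in> carrier A \<Longrightarrow> linear_map_on A s (\<lambda>z. f x y z)"
    and xs: "set xs \<subseteq> carrier A \<times> carrier A \<times> carrier A"
    and B: "finite B" "B \<subseteq> carrier A" "\<And>b. b \<in> B \<Longrightarrow> r b \<in> dual_set A"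
      "\<And>x. x \<in> carrier A \<Longrightarrow> x = (\<Sum>b\<in>B. r b x \<bullet> b)"
  shows "(\<Sum>(x, y, z)\<leftarrow>xs. f x y z) =
    (\<Sum>b\<in>B. \<Sum>c\<in>B. \<Sum>d\<in>B. s ((\<Sum>(x, y, z)\<leftarrow>xs. x \<otimes> y \<otimes> z) (r b) (r c) (r d)) (f b c d))"
  using xs
proof (induction xs)
  interpret s: vector_space s by (rule V)
  case Nil
  show ?case by simp
next
  interpret s: vector_space s by (rule V)
  case (Cons p xs)
  obtain x y z where p: "p = (x, y, z)" by (metis prod_cases3)
  have xyz: "x \<in> carrier A" "y \<in> carrier A" "z \<in> carrier A" using Cons.prems p by auto
  have "f x y z = (\<Sum>b\<in>B. s (r b x) (f b y z))"
    using linear_map_on_expand[OF f(1)[OF xyz(2,3)] B(1,2,4) xyz(1)] by simp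
  also have "\<dots> = (\<Sum>b\<in>B. \<Sum>c\<in>B. \<Sum>d\<in>B. s (r b x * r c y * r d z) (f b c d))"
  proof (rule sum.cong[OF refl])
    fix b assume b: "b \<in> B"
    have "f b y z = (\<Sum>c\<in>B. s (r c y) (f b c z))"
      using linear_map_on_expand[OF f(2) B(1,2,4) xyz(2)] b B(2) xyz by blast
    also have "\<dots> = (\<Sum>c\<in>B. \<Sum>d\<in>B. s (r c y * r d z) (f b c d))"
    proof (rule sum.cong[OF refl])
      fix c assume c: "c \<in> B"
      have "f b c z = (\<Sum>d\<in>B. s (r d z) (f b c d))"
        using linear_map_on_expand[OF f(3) B(1,2,4) xyz(3)] b c B(2) by blast
      then show "s (r c y) (f b c z) = (\<Sum>d\<in>B. s (r c y * r d z) (f b c d))"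
        by (simp add: s.scale_sum_right)
    qed
    finally show "s (r b x) (f b y z) = (\<Sum>c\<in>B. \<Sum>d\<in>B. s (r b x * r c y * r d z) (f b c d))"
      by (simp add: s.scale_sum_right mult.assoc)
  qed
  also have "\<dots> = (\<Sum>b\<in>B. \<Sum>c\<in>B. \<Sum>d\<in>B. s ((x \<otimes> y \<otimes> z) (r b) (r c) (r d)) (f b c d))"
    by (intro sum.cong refl) (simp add: elem3_def B(3))
  finally show ?case
    using Cons by (simp add: p s.scale_left_distrib sum.distrib)
qed

lemma sweedler2_eq:
  assumes "vector_space s"
    and "\<And>y. y \<in> carrier A \<Longrightarrow> linear_map_on A s (\<lambda>x. f x y)"
      "\<And>x. x \<in> carrier A \<Longrightarrow> linear_map_on A s (\<lambda>y. f x y)"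
    and "set xs \<subseteq> carrier A \<times> carrier A"
  shows "sweedler2 A (\<Sum>(x, y)\<leftarrow>xs. x \<otimes> y) f = (\<Sum>(x, y)\<leftarrow>xs. f x y)"
proof -
  obtain B r where B: "finite B" "B \<subseteq> carrier A" "\<And>b. b \<in> B \<Longrightarrow> r b \<in> dual_set A"
      "\<And>x. x \<in> carrier A \<Longrightarrow> x = (\<Sum>b\<in>B. r b x \<bullet> b)"
    using dual_basis by blast
  define ys where "ys = (SOME ys. set ys \<subseteq> carrier A \<times> carrier A \<and>
    (\<Sum>(x, y)\<leftarrow>ys. x \<otimes> y) = (\<Sum>(x, y)\<leftarrow>xs. x \<otimes> y))"
  have ys: "set ys \<subseteq> carrier A \<times> carrier A" "(\<Sum>(x, y)\<leftarrow>ys. x \<otimes> y) = (\<Sum>(x, y)\<leftarrow>xs. x \<otimes> y)"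
    unfolding ys_def by (rule someI2[of _ xs]; use assms(4) in simp)+
  have "sweedler2 A (\<Sum>(x, y)\<leftarrow>xs. x \<otimes> y) f = (\<Sum>(x, y)\<leftarrow>ys. f x y)"
    unfolding sweedler2_def ys_def ..
  also have "\<dots> = (\<Sum>(x, y)\<leftarrow>xs. f x y)"
    using sum_list_bilinear_eq[OF assms(1-3) ys(1) B] sum_list_bilinear_eq[OF assms B] ys(2) by simp
  finally show ?thesis .
qed

lemma sweedler3_eq:
  assumes "vector_space s"
    and "\<And>y z. y \<in> carrier A \<Longrightarrow> z \<in> carrier A \<Longrightarrow> linear_map_on A s (\<lambda>x. f x y z)"
      "\<And>x z. x \<in> carrier A \<Longrightarrow> z \<in> carrier A \<Longrightarrow> linear_map_on A s (\<lambda>y. f x y z)"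
      "\<And>x y. x \<in> carrier A \<Longrightarrow> y \<in> carrier A \<Longrightarrow> linear_map_on A s (\<lambda>z. f x y z)"
    and "set xs \<subseteq> carrier A \<times> carrier A \<times> carrier A"
  shows "sweedler3 A (\<Sum>(x, y, z)\<leftarrow>xs. x \<otimes> y \<otimes> z) f = (\<Sum>(x, y, z)\<leftarrow>xs. f x y z)"
proof -
  obtain B r where B: "finite B" "B \<subseteq> carrier A" "\<And>b. b \<in> B \<Longrightarrow> r b \<in> dual_set A"
      "\<And>x. x \<in> carrier A \<Longrightarrow> x = (\<Sum>b\<in>B. r b x \<bullet> b)"
    using dual_basis by blast
  define ys where "ys = (SOME ys. set ys \<subseteq> carrier A \<times> carrier A \<times> carrier A \<and>
    (\<Sum>(x, y, z)\<leftarrow>ys. x \<otimes> y \<otimes> z) = (\<Sum>(x, y, z)\<leftarrow>xs. x \<otimes> y \<otimes> z))"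
  have ys: "set ys \<subseteq> carrier A \<times> carrier A \<times> carrier A"
    "(\<Sum>(x, y, z)\<leftarrow>ys. x \<otimes> y \<otimes> z) = (\<Sum>(x, y, z)\<leftarrow>xs. x \<otimes> y \<otimes> z)"
    unfolding ys_def by (rule someI2[of _ xs]; use assms(5) in simp)+
  have "sweedler3 A (\<Sum>(x, y, z)\<leftarrow>xs. x \<otimes> y \<otimes> z) f = (\<Sum>(x, y, z)\<leftarrow>ys. f x y z)"
    unfolding sweedler3_def ys_def ..
  also have "\<dots> = (\<Sum>(x, y, z)\<leftarrow>xs. f x y z)"
    using sum_list_trilinear_eq[OF assms(1-4) ys(1) B] sum_list_trilinear_eq[OF assms B] ys(2) by simp
  finally show ?thesis .
qed

end

record ('k, 'a) bialg = "('k, 'a) kspace" +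
  mul :: "'a \<Rightarrow> 'a \<Rightarrow> 'a" (infixl "\<cdot>\<index>" 78)
  unit_elt :: 'a ("\<one>\<index>")
  comul :: "'a \<Rightarrow> ('k, 'a) tensor2" ("\<Delta>\<index>")
  counit :: "'a \<Rightarrow> 'k" ("\<epsilon>\<index>")

locale fd_algebra = fd_space A for A :: "('k::field, 'a::ab_group_add, 'z) bialg_scheme" (structure) +
  assumes mul_closed: "x \<in> carrier A \<Longrightarrow> y \<in> carrier A \<Longrightarrow> x \<cdot> y \<in> carrier A"
    and mul_linear_left: "y \<in> carrier A \<Longrightarrow> linear_map_on A (smul A) (\<lambda>x. x \<cdot> y)"
    and mul_linear_right: "x \<in> carrier A \<Longrightarrow> linear_map_on A (smul A) (\<lambda>y. x \<cdot> y)"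
    and mul_assoc: "\<lbrakk>x \<in> carrier A; y \<in> carrier A; z \<in> carrier A\<rbrakk> \<Longrightarrow> (x \<cdot> y) \<cdot> z = x \<cdot> (y \<cdot> z)"
    and unit_closed: "\<one> \<in> carrier A"
    and unit_left: "x \<in> carrier A \<Longrightarrow> \<one> \<cdot> x = x"
    and unit_right: "x \<in> carrier A \<Longrightarrow> x \<cdot> \<one> = x"

locale fd_coalgebra = fd_space A for A :: "('k::field, 'a::ab_group_add, 'z) bialg_scheme" (structure) +
  assumes comul_closed: "x \<in> carrier A \<Longrightarrow> \<Delta> x \<in> tensors2 A"
    and comul_linear: "linear_map_on A (\<lambda>c t \<phi> \<psi>. c * t \<phi> \<psi>) \<Delta>"
    and counit_linear: "linear_map_on A (*) \<epsilon>"
    and coassoc: "x \<in> carrier A \<Longrightarrow>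
      sweedler2 A (\<Delta> x) (\<lambda>a b. sweedler2 A (\<Delta> a) (\<lambda>a' a''. a' \<otimes> a'' \<otimes> b)) =
      sweedler2 A (\<Delta> x) (\<lambda>a b. sweedler2 A (\<Delta> b) (\<lambda>b' b''. a \<otimes> b' \<otimes> b''))"
    and counit_left: "x \<in> carrier A \<Longrightarrow> sweedler2 A (\<Delta> x) (\<lambda>a b. \<epsilon> a \<bullet> b) = x"
    and counit_right: "x \<in> carrier A \<Longrightarrow> sweedler2 A (\<Delta> x) (\<lambda>a b. \<epsilon> b \<bullet> a) = x"

definition tmul2 :: "('k::field, 'a::ab_group_add, 'z) bialg_scheme \<Rightarrow>
    ('k, 'a) tensor2 \<Rightarrow> ('k, 'a) tensor2 \<Rightarrow> ('k, 'a) tensor2" where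
  "tmul2 A t u = sweedler2 A t (\<lambda>a b. sweedler2 A u (\<lambda>a' b'. (a \<cdot>\<^bsub>A\<^esub> a') \<otimes>\<^bsub>A\<^esub> (b \<cdot>\<^bsub>A\<^esub> b')))"

definition tmul3 :: "('k::field, 'a::ab_group_add, 'z) bialg_scheme \<Rightarrow>
    ('k, 'a) tensor3 \<Rightarrow> ('k, 'a) tensor3 \<Rightarrow> ('k, 'a) tensor3" where
  "tmul3 A t u = sweedler3 A t (\<lambda>a b c. sweedler3 A u (\<lambda>a' b' c'.
     (a \<cdot>\<^bsub>A\<^esub> a') \<otimes>\<^bsub>A\<^esub> (b \<cdot>\<^bsub>A\<^esub> b') \<otimes> (c \<cdot>\<^bsub>A\<^esub> c')))"

locale weak_bialgebra = fd_algebra A + fd_coalgebra A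
  for A :: "('k::field, 'a::ab_group_add, 'z) bialg_scheme" (structure) +
  assumes comul_mul: "x \<in> carrier A \<Longrightarrow> y \<in> carrier A \<Longrightarrow> \<Delta> (x \<cdot> y) = tmul2 A (\<Delta> x) (\<Delta> y)"

text \<open>The dual, with the transposed structure; \<open>dual_comul_unique\<close> below justifies \<open>THE\<close>.\<close>

definition dual :: "('k::field, 'a::ab_group_add, 'z) bialg_scheme \<Rightarrow> ('k, 'a \<Rightarrow> 'k) bialg" where
  "dual A = kspace.extend (dual_space A)
    \<lparr>mul = (\<lambda>\<phi> \<psi> x. if x \<in> carrier A then sweedler2 A (\<Delta>\<^bsub>A\<^esub> x) (\<lambda>a b. \<phi> a * \<psi> b) else 0),
     unit_elt = (\<lambda>x. if x \<in> carrier A then \<epsilon>\<^bsub>A\<^esub> x else 0),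
     comul = (\<lambda>\<phi>. THE t. t \<in> tensors2 (dual_space A) \<and> (\<forall>x\<in>carrier A. \<forall>y\<in>carrier A.
       sweedler2 (dual_space A) t (\<lambda>\<psi> \<chi>. \<psi> x * \<chi> y) = \<phi> (x \<cdot>\<^bsub>A\<^esub> y))),
     counit = (\<lambda>\<phi>. \<phi> \<one>\<^bsub>A\<^esub>)\<rparr>"

lemma dual_space_simps [simp]:
  "carrier (dual_space A) = dual_set A" "smul (dual_space A) = (\<lambda>c \<phi> x. c * \<phi> x)"
  by (simp_all add: dual_space_def)

lemma dual_simps [simp]:
  "carrier (dual A) = dual_set A" "smul (dual A) = (\<lambda>c \<phi> x. c * \<phi> x)"
  "mul (dual A) = (\<lambda>\<phi> \<psi> x. if x \<in> carrier A then sweedler2 A (\<Delta>\<^bsub>A\<^esub> x) (\<lambda>a b. \<phi> a * \<psi> b) else 0)"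
  "unit_elt (dual A) = (\<lambda>x. if x \<in> carrier A then \<epsilon>\<^bsub>A\<^esub> x else 0)"
  "comul (dual A) = (\<lambda>\<phi>. THE t. t \<in> tensors2 (dual_space A) \<and> (\<forall>x\<in>carrier A. \<forall>y\<in>carrier A.
     sweedler2 (dual_space A) t (\<lambda>\<psi> \<chi>. \<psi> x * \<chi> y) = \<phi> (x \<cdot>\<^bsub>A\<^esub> y)))"
  "counit (dual A) = (\<lambda>\<phi>. \<phi> \<one>\<^bsub>A\<^esub>)"
  by (simp_all add: dual_def dual_space_def kspace.defs)

lemma dual_same_tensors:
  "elem2 (dual A) = elem2 (dual_space A)" "elem3 (dual A) = elem3 (dual_space A)"
  "tensors2 (dual A) = tensors2 (dual_space A)" "tensors3 (dual A) = tensors3 (dual_space A)"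
  "sweedler2 (dual A) = sweedler2 (dual_space A)" "sweedler3 (dual A) = sweedler3 (dual_space A)"
proof -
  have "dual_set (dual A) = dual_set (dual_space A)" unfolding dual_set_def by simp
  then show "elem2 (dual A) = elem2 (dual_space A)" "elem3 (dual A) = elem3 (dual_space A)"
    by (auto simp: elem2_def elem3_def intro!: ext)
  then show "tensors2 (dual A) = tensors2 (dual_space A)" "tensors3 (dual A) = tensors3 (dual_space A)"
    "sweedler2 (dual A) = sweedler2 (dual_space A)" "sweedler3 (dual A) = sweedler3 (dual_space A)"
    by (auto simp: tensors2_def tensors3_def sweedler2_def sweedler3_def intro!: ext)
qed

lemma vector_space_mult: "vector_space ((*) :: 'k::field \<Rightarrow> 'k \<Rightarrow> 'k)"
  by unfold_locales (auto simp: algebra_simps)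

lemma vector_space_fun: "vector_space (\<lambda>(c::'k::field) (\<phi> :: 'a \<Rightarrow> 'k) x. c * \<phi> x)"
  by unfold_locales (auto simp: algebra_simps fun_eq_iff)

lemma (in fd_space) dual_expand:
  assumes "\<phi> \<in> dual_set A" "finite B" "B \<subseteq> carrier A" "\<And>b. b \<in> B \<Longrightarrow> r b \<in> dual_set A"
    "\<And>x. x \<in> carrier A \<Longrightarrow> x = (\<Sum>b\<in>B. r b x \<bullet> b)"
  shows "\<phi> = (\<Sum>b\<in>B. (\<lambda>x. \<phi> b * r b x))"
proof
  fix x
  show "\<phi> x = (\<Sum>b\<in>B. (\<lambda>x. \<phi> b * r b x)) x"
  proof (cases "x \<in> carrier A")
    case True
    have "linear_map_on A (*) \<phi>" using assms(1) by (auto simp: dual_set_def linear_map_on_def)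
    from linear_map_on_expand[OF this assms(2,3,5) True] show ?thesis
      by (simp add: sum_fun_apply mult.commute)
  next
    case False
    then have "\<phi> x = 0" "b \<in> B \<Longrightarrow> r b x = 0" for b
      using assms(1,4) by (auto simp: dual_set_def)
    then show ?thesis by (simp add: sum_fun_apply)
  qed
qed

lemma (in fd_space) fd_space_dual: "fd_space (dual_space A)"
proof -
  interpret D: vector_space "\<lambda>(c::'k) (\<phi> :: 'a \<Rightarrow> 'k) x. c * \<phi> x" by (rule vector_space_fun)
  obtain B r where B: "finite B" "B \<subseteq> carrier A" "\<And>b. b \<in> B \<Longrightarrow> r b \<in> dual_set A"
      "\<And>x. x \<in> carrier A \<Longrightarrow> x = (\<Sum>b\<in>B. r b x \<bullet> b)"
    using dual_basis by blast
  have sub: "D.subspace (dual_set A)"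
    unfolding D.subspace_def dual_set_def by (auto simp: algebra_simps)
  have "D.span (r ` B) = dual_set A"
  proof
    show "D.span (r ` B) \<subseteq> dual_set A" using B(3) sub by (intro D.span_minimal) auto
    show "dual_set A \<subseteq> D.span (r ` B)"
    proof
      fix \<phi> assume "\<phi> \<in> dual_set A"
      have "(\<Sum>b\<in>B. (\<lambda>x. \<phi> b * r b x)) \<in> D.span (r ` B)"
        by (intro D.span_sum D.span_scale D.span_base imageI)
      moreover have "\<phi> = (\<Sum>b\<in>B. (\<lambda>x. \<phi> b * r b x))"
        using dual_expand[OF \<open>\<phi> \<in> dual_set A\<close> B] by blast
      ultimately show "\<phi> \<in> D.span (r ` B)" by (rule ssubst[rotated])
    qed
  qed
  then have "\<exists>S. finite S \<and> D.span S = dual_set A" using B(1) by blast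
  then show ?thesis
    by (simp add: fd_space_def vector_space_fun)
qed

lemma (in fd_space) sweedler2_dual:
  assumes "set us \<subseteq> dual_set A \<times> dual_set A" "x \<in> carrier A" "y \<in> carrier A"
  shows "sweedler2 (dual_space A) (\<Sum>(\<psi>, \<chi>)\<leftarrow>us. \<psi> \<otimes>\<^bsub>dual_space A\<^esub> \<chi>) (\<lambda>\<psi> \<chi>. \<psi> x * \<chi> y) =
    (\<Sum>(\<psi>, \<chi>)\<leftarrow>us. \<psi> x * \<chi> y)"
proof -
  interpret D: fd_space "dual_space A" by (rule fd_space_dual)
  show ?thesis
    by (rule D.sweedler2_eq[OF vector_space_mult])
      (use assms in \<open>auto simp: linear_map_on_def algebra_simps\<close>)
qed

lemma (in fd_algebra) dual_comul_unique:
  assumes "\<phi> \<in> dual_set A"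
  shows "\<exists>!t. t \<in> tensors2 (dual_space A) \<and> (\<forall>x\<in>carrier A. \<forall>y\<in>carrier A.
    sweedler2 (dual_space A) t (\<lambda>\<psi> \<chi>. \<psi> x * \<chi> y) = \<phi> (x \<cdot> y))"
proof -
  obtain B r where B: "finite B" "B \<subseteq> carrier A" "\<And>b. b \<in> B \<Longrightarrow> r b \<in> dual_set A"
      "\<And>x. x \<in> carrier A \<Longrightarrow> x = (\<Sum>b\<in>B. r b x \<bullet> b)"
    using dual_basis by blast
  interpret D: fd_space "dual_space A" by (rule fd_space_dual)
  obtain bs where bs: "set bs = B" "distinct bs" using finite_distinct_list[OF B(1)] by auto
  have lin: "linear_map_on A (*) \<phi>" using assms by (auto simp: dual_set_def linear_map_on_def)
  define us where "us = concat (map (\<lambda>b. map (\<lambda>c. (\<lambda>x. \<phi> (b \<cdot> c) * r b x, r c)) bs) bs)"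
  have us: "set us \<subseteq> dual_set A \<times> dual_set A"
    using B(3) bs(1) by (auto simp: us_def dual_set_def algebra_simps)
  have ex: "sweedler2 (dual_space A) (\<Sum>(\<psi>, \<chi>)\<leftarrow>us. \<psi> \<otimes>\<^bsub>dual_space A\<^esub> \<chi>) (\<lambda>\<psi> \<chi>. \<psi> x * \<chi> y) = \<phi> (x \<cdot> y)"
    if xy: "x \<in> carrier A" "y \<in> carrier A" for x y
  proof -
    have l: "linear_map_on A (*) (\<lambda>x. \<phi> (x \<cdot> y))" if "y \<in> carrier A" for y
      using lin mul_linear_left[OF that] mul_closed that by (auto simp: linear_map_on_def)
    have r: "linear_map_on A (*) (\<lambda>y. \<phi> (x \<cdot> y))" if "x \<in> carrier A" for x
      using lin mul_linear_right[OF that] mul_closed that by (auto simp: linear_map_on_def)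
    have sl: "(\<Sum>p\<leftarrow>concat (map g xs). h p) = (\<Sum>x\<leftarrow>xs. \<Sum>p\<leftarrow>g x. h p)"
      for g :: "'a \<Rightarrow> 'q list" and h :: "'q \<Rightarrow> 'k" and xs
      by (induction xs) auto
    have "(\<Sum>(\<psi>, \<chi>)\<leftarrow>us. \<psi> x * \<chi> y) = (\<Sum>b\<leftarrow>bs. \<Sum>c\<leftarrow>bs. \<phi> (b \<cdot> c) * r b x * r c y)"
      unfolding us_def sl by (simp add: o_def)
    also have "\<dots> = (\<Sum>b\<in>B. \<Sum>c\<in>B. \<phi> (b \<cdot> c) * r b x * r c y)"
      using bs by (simp add: sum_list_distinct_conv_sum_set)
    also have "\<dots> = (\<Sum>b\<in>B. r b x * \<phi> (b \<cdot> y))"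
    proof (rule sum.cong[OF refl])
      fix b assume "b \<in> B"
      then have "b \<in> carrier A" using B(2) by auto
      from linear_map_on_expand[OF r[OF this] B(1,2,4) xy(2)]
      show "(\<Sum>c\<in>B. \<phi> (b \<cdot> c) * r b x * r c y) = r b x * \<phi> (b \<cdot> y)"
        by (simp add: sum_distrib_left algebra_simps)
    qed
    also have "\<dots> = \<phi> (x \<cdot> y)"
      using linear_map_on_expand[OF l[OF xy(2)] B(1,2,4) xy(1)] by simp
    finally show ?thesis using sweedler2_dual[OF us xy] by simp
  qed
  have un: "t = t'"
    if t: "t \<in> tensors2 (dual_space A)" "t' \<in> tensors2 (dual_space A)"
      and eq: "\<And>x y. x \<in> carrier A \<Longrightarrow> y \<in> carrier A \<Longrightarrow>
        sweedler2 (dual_space A) t (\<lambda>\<psi> \<chi>. \<psi> x * \<chi> y) = sweedler2 (dual_space A) t' (\<lambda>\<psi> \<chi>. \<psi> x * \<chi> y)" for t t'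
  proof (intro ext)
    fix \<Phi> \<Psi>
    have exp: "s \<Phi> \<Psi> = (if \<Phi> \<in> dual_set (dual_space A) \<and> \<Psi> \<in> dual_set (dual_space A) then
       (\<Sum>b\<in>B. \<Sum>c\<in>B. sweedler2 (dual_space A) s (\<lambda>\<psi> \<chi>. \<psi> b * \<chi> c) * (\<Phi> (r b) * \<Psi> (r c))) else 0)"
      if "s \<in> tensors2 (dual_space A)" for s
    proof -
      from that obtain vs where vs: "set vs \<subseteq> dual_set A \<times> dual_set A"
        "s = (\<Sum>(\<psi>, \<chi>)\<leftarrow>vs. \<psi> \<otimes>\<^bsub>dual_space A\<^esub> \<chi>)"
        by (auto simp: tensors2_def)
      have sd: "sweedler2 (dual_space A) s (\<lambda>\<psi> \<chi>. \<psi> b * \<chi> c) = (\<Sum>(\<psi>, \<chi>)\<leftarrow>vs. \<psi> b * \<chi> c)"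
        if "b \<in> B" "c \<in> B" for b c
        using sweedler2_dual[OF vs(1)] that B(2) vs(2) by blast
      have sa: "s \<Phi> \<Psi> = (\<Sum>p\<leftarrow>vs. (fst p \<otimes>\<^bsub>dual_space A\<^esub> snd p) \<Phi> \<Psi>)"
        by (simp add: vs(2) sum_list_fun_apply case_prod_beta)
      show ?thesis
      proof (cases "\<Phi> \<in> dual_set (dual_space A) \<and> \<Psi> \<in> dual_set (dual_space A)")
        case False
        then show ?thesis by (auto simp: sa elem2_def)
      next
        case True
        have lin: "linear_map_on (dual_space A) (*) \<Phi>" "linear_map_on (dual_space A) (*) \<Psi>"
          using True by (auto simp: dual_set_def linear_map_on_def)
        have ev: "\<Theta> \<psi> = (\<Sum>b\<in>B. \<psi> b * \<Theta> (r b))"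
          if \<Theta>: "linear_map_on (dual_space A) (*) \<Theta>" and \<psi>: "\<psi> \<in> dual_set A" for \<Theta> \<psi>
        proof -
          interpret V: vector_space "\<lambda>(c::'k) (\<phi> :: 'a \<Rightarrow> 'k) x. c * \<phi> x" by (rule vector_space_fun)
          have S: "V.subspace (dual_set A)" using D.subspace_carrier by simp
          have "\<Theta> (\<Sum>b\<in>C. (\<lambda>x. \<psi> b * r b x)) = (\<Sum>b\<in>C. \<psi> b * \<Theta> (r b))" if "C \<subseteq> B" for C
            using finite_subset[OF that B(1)] that
          proof (induction C rule: finite_induct)
            case empty
            have "\<Theta> (0 + 0) = \<Theta> 0 + \<Theta> 0"
              using \<Theta> V.subspace_0[OF S] unfolding linear_map_on_def by (metis dual_space_simps(1))
            then have "\<Theta> 0 = 0" by (simp only: add_0_left add_cancel_right_right)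
            then show ?case by (simp only: sum.empty)
          next
            case (insert b C)
            have 1: "(\<lambda>x. \<psi> b * r b x) \<in> dual_set A"
              using V.subspace_scale[OF S] B(3) insert.prems by auto
            have 2: "(\<Sum>b\<in>C. (\<lambda>x. \<psi> b * r b x)) \<in> dual_set A"
              by (rule V.subspace_sum[OF S]) (use V.subspace_scale[OF S] B(3) insert.prems in auto)
            have "\<Theta> (\<lambda>x. \<psi> b * r b x) = \<psi> b * \<Theta> (r b)"
              using \<Theta> B(3) insert.prems by (auto simp: linear_map_on_def)
            moreover have "\<Theta> ((\<lambda>x. \<psi> b * r b x) + (\<Sum>b\<in>C. (\<lambda>x. \<psi> b * r b x))) =
                \<Theta> (\<lambda>x. \<psi> b * r b x) + \<Theta> (\<Sum>b\<in>C. (\<lambda>x. \<psi> b * r b x))"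
              using \<Theta> 1 2 unfolding linear_map_on_def by simp
            ultimately show ?case using insert by (simp add: plus_fun_def)
          qed
          then have "\<Theta> (\<Sum>b\<in>B. (\<lambda>x. \<psi> b * r b x)) = (\<Sum>b\<in>B. \<psi> b * \<Theta> (r b))" by blast
          moreover have "\<psi> = (\<Sum>b\<in>B. (\<lambda>x. \<psi> b * r b x))" using dual_expand[OF \<psi> B] by blast
          ultimately show ?thesis by (rule ssubst[rotated, where P = "\<lambda>v. \<Theta> v = _"])
        qed
        have "s \<Phi> \<Psi> = (\<Sum>p\<leftarrow>vs. \<Phi> (fst p) * \<Psi> (snd p))"
          using True by (simp add: sa elem2_def)
        also have "\<dots> = (\<Sum>p\<leftarrow>vs. \<Sum>b\<in>B. \<Sum>c\<in>B. fst p b * snd p c * (\<Phi> (r b) * \<Psi> (r c)))"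
        proof (intro arg_cong[where f = sum_list] map_cong refl)
          fix p assume "p \<in> set vs"
          then have "fst p \<in> dual_set A" "snd p \<in> dual_set A" using vs(1) by auto
          then have "\<Phi> (fst p) * \<Psi> (snd p) = (\<Sum>b\<in>B. fst p b * \<Phi> (r b)) * (\<Sum>c\<in>B. snd p c * \<Psi> (r c))"
            by (intro arg_cong2[where f = "(*)"] ev lin)
          then show "\<Phi> (fst p) * \<Psi> (snd p) = (\<Sum>b\<in>B. \<Sum>c\<in>B. fst p b * snd p c * (\<Phi> (r b) * \<Psi> (r c)))"
            by (simp only: sum_product mult_ac)
        qed
        also have "\<dots> = (\<Sum>b\<in>B. \<Sum>c\<in>B. (\<Sum>p\<leftarrow>vs. fst p b * snd p c) * (\<Phi> (r b) * \<Psi> (r c)))"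
          by (induction vs) (simp_all add: sum.distrib distrib_right)
        also have "\<dots> = (\<Sum>b\<in>B. \<Sum>c\<in>B. sweedler2 (dual_space A) s (\<lambda>\<psi> \<chi>. \<psi> b * \<chi> c) * (\<Phi> (r b) * \<Psi> (r c)))"
          using sd by (intro sum.cong refl) (simp add: case_prod_unfold)
        finally show ?thesis using True by simp
      qed
    qed
    have "sweedler2 (dual_space A) t (\<lambda>\<psi> \<chi>. \<psi> b * \<chi> c) = sweedler2 (dual_space A) t' (\<lambda>\<psi> \<chi>. \<psi> b * \<chi> c)"
      if "b \<in> B" "c \<in> B" for b c
      using eq that B(2) by blast
    then show "t \<Phi> \<Psi> = t' \<Phi> \<Psi>"
      unfolding exp[OF t(1)] exp[OF t(2)] by (simp cong: sum.cong)
  qed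
  show ?thesis
  proof (rule ex_ex1I)
    have "(\<Sum>(\<psi>, \<chi>)\<leftarrow>us. \<psi> \<otimes>\<^bsub>dual_space A\<^esub> \<chi>) \<in> tensors2 (dual_space A)"
      using us by (auto simp: tensors2_def)
    with ex show "\<exists>t. t \<in> tensors2 (dual_space A) \<and> (\<forall>x\<in>carrier A. \<forall>y\<in>carrier A.
      sweedler2 (dual_space A) t (\<lambda>\<psi> \<chi>. \<psi> x * \<chi> y) = \<phi> (x \<cdot> y))" by blast
  next fix t t' assume "t \<in> tensors2 (dual_space A) \<and> (\<forall>x\<in>carrier A. \<forall>y\<in>carrier A.
      sweedler2 (dual_space A) t (\<lambda>\<psi> \<chi>. \<psi> x * \<chi> y) = \<phi> (x \<cdot> y))"
     "t' \<in> tensors2 (dual_space A) \<and> (\<forall>x\<in>carrier A. \<forall>y\<in>carrier A.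
      sweedler2 (dual_space A) t' (\<lambda>\<psi> \<chi>. \<psi> x * \<chi> y) = \<phi> (x \<cdot> y))"
    then show "t = t'" by (intro un) metis+
  qed
qed

definition comul_one_left :: "('k::field, 'a::ab_group_add, 'z) bialg_scheme \<Rightarrow> ('k, 'a) tensor3" where
  "comul_one_left A = sweedler2 A (\<Delta>\<^bsub>A\<^esub> \<one>\<^bsub>A\<^esub>) (\<lambda>a b. a \<otimes>\<^bsub>A\<^esub> b \<otimes> \<one>\<^bsub>A\<^esub>)"

definition comul_one_right :: "('k::field, 'a::ab_group_add, 'z) bialg_scheme \<Rightarrow> ('k, 'a) tensor3" where
  "comul_one_right A = sweedler2 A (\<Delta>\<^bsub>A\<^esub> \<one>\<^bsub>A\<^esub>) (\<lambda>a b. \<one>\<^bsub>A\<^esub> \<otimes>\<^bsub>A\<^esub> a \<otimes> b)"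

definition comul2_one :: "('k::field, 'a::ab_group_add, 'z) bialg_scheme \<Rightarrow> ('k, 'a) tensor3" where
  "comul2_one A = sweedler2 A (\<Delta>\<^bsub>A\<^esub> \<one>\<^bsub>A\<^esub>) (\<lambda>a b. sweedler2 A (\<Delta>\<^bsub>A\<^esub> a) (\<lambda>a' a''. a' \<otimes>\<^bsub>A\<^esub> a'' \<otimes> b))"

definition left_comonoidal :: "('k::field, 'a::ab_group_add, 'z) bialg_scheme \<Rightarrow> bool" where
  "left_comonoidal A \<longleftrightarrow> tmul3 A (comul_one_left A) (comul_one_right A) = comul2_one A"

definition right_comonoidal :: "('k::field, 'a::ab_group_add, 'z) bialg_scheme \<Rightarrow> bool" where
  "right_comonoidal A \<longleftrightarrow> tmul3 A (comul_one_right A) (comul_one_left A) = comul2_one A"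

definition comonoidal :: "('k::field, 'a::ab_group_add, 'z) bialg_scheme \<Rightarrow> bool" where
  "comonoidal A \<longleftrightarrow> left_comonoidal A \<and> right_comonoidal A"

definition left_base :: "('k::field, 'a::ab_group_add, 'z) bialg_scheme \<Rightarrow> 'a set" where
  "left_base A = {sweedler2 A (\<Delta>\<^bsub>A\<^esub> \<one>\<^bsub>A\<^esub>) (\<lambda>a b. \<phi> a \<bullet>\<^bsub>A\<^esub> b) | \<phi>. \<phi> \<in> dual_set A}"

definition right_base :: "('k::field, 'a::ab_group_add, 'z) bialg_scheme \<Rightarrow> 'a set" where
  "right_base A = {sweedler2 A (\<Delta>\<^bsub>A\<^esub> \<one>\<^bsub>A\<^esub>) (\<lambda>a b. \<phi> b \<bullet>\<^bsub>A\<^esub> a) | \<phi>. \<phi> \<in> dual_set A}"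

definition commuting :: "('k::field, 'a::ab_group_add, 'z) bialg_scheme \<Rightarrow> 'a set \<Rightarrow> 'a set \<Rightarrow> bool" where
  "commuting A S T \<longleftrightarrow> (\<forall>x\<in>S. \<forall>y\<in>T. x \<cdot>\<^bsub>A\<^esub> y = y \<cdot>\<^bsub>A\<^esub> x)"

definition center :: "('k::field, 'a::ab_group_add, 'z) bialg_scheme \<Rightarrow> 'a set" where
  "center A = {z \<in> carrier A. \<forall>x\<in>carrier A. z \<cdot>\<^bsub>A\<^esub> x = x \<cdot>\<^bsub>A\<^esub> z}"

definition N_LL :: "('k::field, 'a::ab_group_add, 'z) bialg_scheme \<Rightarrow> 'a set" where
  "N_LL B = {b \<in> carrier B. \<Delta>\<^bsub>B\<^esub> b = sweedler2 B (\<Delta>\<^bsub>B\<^esub> \<one>\<^bsub>B\<^esub>) (\<lambda>u v. (b \<cdot>\<^bsub>B\<^esub> u) \<otimes>\<^bsub>B\<^esub> v)}"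

definition N_LR :: "('k::field, 'a::ab_group_add, 'z) bialg_scheme \<Rightarrow> 'a set" where
  "N_LR B = {b \<in> carrier B. \<Delta>\<^bsub>B\<^esub> b = sweedler2 B (\<Delta>\<^bsub>B\<^esub> \<one>\<^bsub>B\<^esub>) (\<lambda>u v. (u \<cdot>\<^bsub>B\<^esub> b) \<otimes>\<^bsub>B\<^esub> v)}"

definition N_RL :: "('k::field, 'a::ab_group_add, 'z) bialg_scheme \<Rightarrow> 'a set" where
  "N_RL B = {b \<in> carrier B. \<Delta>\<^bsub>B\<^esub> b = sweedler2 B (\<Delta>\<^bsub>B\<^esub> \<one>\<^bsub>B\<^esub>) (\<lambda>u v. u \<otimes>\<^bsub>B\<^esub> (b \<cdot>\<^bsub>B\<^esub> v))}"

definition N_RR :: "('k::field, 'a::ab_group_add, 'z) bialg_scheme \<Rightarrow> 'a set" where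
  "N_RR B = {b \<in> carrier B. \<Delta>\<^bsub>B\<^esub> b = sweedler2 B (\<Delta>\<^bsub>B\<^esub> \<one>\<^bsub>B\<^esub>) (\<lambda>u v. u \<otimes>\<^bsub>B\<^esub> (v \<cdot>\<^bsub>B\<^esub> b))}"

text \<open>By \<open>N_center\<close> below, \<open>N_LR\<close> and \<open>N_RR\<close> could equally be used here.\<close>

definition C_L :: "('k::field, 'a::ab_group_add, 'z) bialg_scheme \<Rightarrow> 'a set" where
  "C_L B = N_LL B \<inter> center B"

definition C_R :: "('k::field, 'a::ab_group_add, 'z) bialg_scheme \<Rightarrow> 'a set" where
  "C_R B = N_RL B \<inter> center B"

lemma sweedler2_cong:
  assumes "t \<in> tensors2 A" "\<And>x y. x \<in> carrier A \<Longrightarrow> y \<in> carrier A \<Longrightarrow> f x y = g x y"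
  shows "sweedler2 A t f = sweedler2 A t g"
proof -
  define xs where "xs = (SOME xs. set xs \<subseteq> carrier A \<times> carrier A \<and> (\<Sum>(x, y)\<leftarrow>xs. x \<otimes>\<^bsub>A\<^esub> y) = t)"
  have "\<exists>xs. set xs \<subseteq> carrier A \<times> carrier A \<and> (\<Sum>(x, y)\<leftarrow>xs. x \<otimes>\<^bsub>A\<^esub> y) = t"
    using assms(1) by (auto simp: tensors2_def)
  from someI_ex[OF this] have "set xs \<subseteq> carrier A \<times> carrier A" by (simp add: xs_def)
  then have "(\<Sum>(x, y)\<leftarrow>xs. f x y) = (\<Sum>(x, y)\<leftarrow>xs. g x y)"
    using assms(2) by (intro arg_cong[where f = sum_list] map_cong) auto
  then show ?thesis by (simp add: sweedler2_def xs_def)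
qed

lemma N_center:
  assumes "\<Delta>\<^bsub>B\<^esub> \<one>\<^bsub>B\<^esub> \<in> tensors2 B"
  shows "N_LL B \<inter> center B = N_LR B \<inter> center B" "N_RL B \<inter> center B = N_RR B \<inter> center B"
proof -
  have "sweedler2 B (\<Delta>\<^bsub>B\<^esub> \<one>\<^bsub>B\<^esub>) (\<lambda>u v. (b \<cdot>\<^bsub>B\<^esub> u) \<otimes>\<^bsub>B\<^esub> v) = sweedler2 B (\<Delta>\<^bsub>B\<^esub> \<one>\<^bsub>B\<^esub>) (\<lambda>u v. (u \<cdot>\<^bsub>B\<^esub> b) \<otimes>\<^bsub>B\<^esub> v)"
    "sweedler2 B (\<Delta>\<^bsub>B\<^esub> \<one>\<^bsub>B\<^esub>) (\<lambda>u v. u \<otimes>\<^bsub>B\<^esub> (b \<cdot>\<^bsub>B\<^esub> v)) = sweedler2 B (\<Delta>\<^bsub>B\<^esub> \<one>\<^bsub>B\<^esub>) (\<lambda>u v. u \<otimes>\<^bsub>B\<^esub> (v \<cdot>\<^bsub>B\<^esub> b))"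
    if "b \<in> center B" for b
    using that by (auto intro!: sweedler2_cong[OF assms] simp: center_def)
  then show "N_LL B \<inter> center B = N_LR B \<inter> center B" "N_RL B \<inter> center B = N_RR B \<inter> center B"
    unfolding N_LL_def N_LR_def N_RL_def N_RR_def by auto
qed

definition subalgebra :: "('k::field, 'a::ab_group_add, 'z) bialg_scheme \<Rightarrow> 'a set \<Rightarrow> bool" where
  "subalgebra A S \<longleftrightarrow> S \<subseteq> carrier A \<and> module.subspace (smul A) S \<and> \<one>\<^bsub>A\<^esub> \<in> S
     \<and> (\<forall>x\<in>S. \<forall>y\<in>S. x \<cdot>\<^bsub>A\<^esub> y \<in> S)"

definition algebras_iso :: "('k::field, 'a::ab_group_add, 'z) bialg_scheme \<Rightarrow> 'a set \<Rightarrow>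
    ('k, 'b::ab_group_add, 'w) bialg_scheme \<Rightarrow> 'b set \<Rightarrow> bool" where
  "algebras_iso A S B T \<longleftrightarrow> subalgebra A S \<and> subalgebra B T \<and>
     (\<exists>f. bij_betw f S T \<and>
       (\<forall>x\<in>S. \<forall>y\<in>S. f (x + y) = f x + f y) \<and>
       (\<forall>c. \<forall>x\<in>S. f (c \<bullet>\<^bsub>A\<^esub> x) = c \<bullet>\<^bsub>B\<^esub> f x) \<and>
       (\<forall>x\<in>S. \<forall>y\<in>S. f (x \<cdot>\<^bsub>A\<^esub> y) = f x \<cdot>\<^bsub>B\<^esub> f y) \<and>
       f \<one>\<^bsub>A\<^esub> = \<one>\<^bsub>B\<^esub>)"

end

theory Submission
  imports Defs
begin

text \<open>
  For functionals \<open>\<phi>\<close>, \<open>\<chi>\<close> put \<open>u\<^sub>\<phi> = \<langle>\<phi> | 1\<^sub>(\<^sub>1\<^sub>)\<rangle> 1\<^sub>(\<^sub>2\<^sub>)\<close> and \<open>v\<^sub>\<chi> = 1\<^sub>(\<^sub>1\<^sub>) \<langle>\<chi> | 1\<^sub>(\<^sub>2\<^sub>)\<rangle>\<close>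
  (\<open>base_L\<close> and \<open>base_R\<close> below). Pairing the two comonoidality axioms with \<open>\<phi> \<otimes> \<psi> \<otimes> \<chi>\<close> turns their left-hand
  sides into \<open>\<psi> (u\<^sub>\<phi> v\<^sub>\<chi>)\<close> and \<open>\<psi> (v\<^sub>\<chi> u\<^sub>\<phi>)\<close>, whence the equivalences; the right-hand side becomes
  \<open>\<langle>\<psi> \<otimes> \<chi> | \<Delta> u\<^sub>\<phi>\<rangle> = \<langle>\<phi> \<otimes> \<psi> | \<Delta> v\<^sub>\<chi>\<rangle>\<close>, so that in the comonoidal case the left base is \<open>N\<^sub>L\<^sub>L\<close> and lies in
  \<open>N\<^sub>L\<^sub>R\<close>, and the right base is \<open>N\<^sub>R\<^sub>L\<close> and lies in \<open>N\<^sub>R\<^sub>R\<close>. An element \<open>x\<close> of both bases is sent to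
  the functional \<open>\<epsilon>(x _)\<close> in \<open>C\<^sub>L\<close> of the dual and to \<open>\<epsilon>(_ x)\<close> in \<open>C\<^sub>R\<close> of the dual; the inverse of either
  map is \<open>\<phi> \<mapsto> u\<^sub>\<phi>\<close>, which equals \<open>v\<^sub>\<phi>\<close> because \<open>\<phi>\<close> is central.
\<close>

section \<open>Calculus of Sweedler sums\<close>

text \<open>Names the list that \<open>sweedler2\<close> chooses, so that facts about lists apply to
  Sweedler sums directly.\<close>

definition presentation :: "('k::field, 'a::ab_group_add, 'z) kspace_scheme \<Rightarrow> ('k, 'a) tensor2 \<Rightarrow> ('a \<times> 'a) list"
  where "presentation A t = (SOME xs. set xs \<subseteq> carrier A \<times> carrier A \<and>
      (\<Sum>(x, y)\<leftarrow>xs. x \<otimes>\<^bsub>A\<^esub> y) = t)"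

lemma sweedler2_presentation: "sweedler2 A t f = (\<Sum>(x, y)\<leftarrow>presentation A t. f x y)"
  by (simp add: sweedler2_def presentation_def)

lemma
  assumes "t \<in> tensors2 A"
  shows presentation_subset: "set (presentation A t) \<subseteq> carrier A \<times> carrier A"
    and presentation_sum: "(\<Sum>(x, y)\<leftarrow>presentation A t. x \<otimes>\<^bsub>A\<^esub> y) = t"
proof -
  have "\<exists>xs. set xs \<subseteq> carrier A \<times> carrier A \<and> (\<Sum>(x, y)\<leftarrow>xs. x \<otimes>\<^bsub>A\<^esub> y) = t"
    using assms by (auto simp: tensors2_def)
  from someI_ex[OF this]
  show "set (presentation A t) \<subseteq> carrier A \<times> carrier A"
    "(\<Sum>(x, y)\<leftarrow>presentation A t. x \<otimes>\<^bsub>A\<^esub> y) = t"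
    by (simp_all add: presentation_def)
qed

text \<open>Tensors are functions, so a tensor-valued Sweedler sum can be evaluated one argument at
  a time; this reduces tensor identities to scalar ones.\<close>

lemma sweedler2_fun_apply: "sweedler2 A t f x = sweedler2 A t (\<lambda>a b. f a b x)"
  by (simp add: sweedler2_def sum_list_fun_apply case_prod_unfold)

lemma sweedler3_fun_apply: "sweedler3 A t f x = sweedler3 A t (\<lambda>a b c. f a b c x)"
  by (simp add: sweedler3_def sum_list_fun_apply case_prod_unfold)

lemma sweedler2_zero [simp]: "sweedler2 A t (\<lambda>a b. 0) = 0"
  by (simp add: sweedler2_def case_prod_unfold)

lemma sweedler3_zero [simp]: "sweedler3 A t (\<lambda>a b c. 0) = 0"
  by (simp add: sweedler3_def case_prod_unfold)

lemma sweedler2_add: "sweedler2 A t (\<lambda>a b. f a b + g a b) = sweedler2 A t f + sweedler2 A t g"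
  by (simp add: sweedler2_def case_prod_unfold sum_list_addf)

lemma sweedler2_mult_left: "sweedler2 A t (\<lambda>a b. c * f a b) = c * sweedler2 A t f"
  for c :: "'c::ring"
  by (simp add: sweedler2_def case_prod_unfold sum_list_const_mult)

lemma sweedler2_mult_right: "sweedler2 A t (\<lambda>a b. f a b * c) = sweedler2 A t f * c"
  for c :: "'c::ring"
  by (simp add: sweedler2_def case_prod_unfold sum_list_mult_const)

text \<open>Both sides are double sums over two fixed lists. The spaces may differ, which later lets
  a sum over a coproduct in \<open>A\<close> pass a sum over a coproduct in the dual.\<close>

lemma sweedler2_swap:
  "sweedler2 A t (\<lambda>a b. sweedler2 B u (\<lambda>c d. f a b c d)) =
   sweedler2 B u (\<lambda>c d. sweedler2 A t (\<lambda>a b. f a b c d))"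
proof -
  have "(\<Sum>p\<leftarrow>xs. \<Sum>q\<leftarrow>ys. g p q) = (\<Sum>q\<leftarrow>ys. \<Sum>p\<leftarrow>xs. g p q)"
    for xs :: "'x list" and ys :: "'y list" and g :: "'x \<Rightarrow> 'y \<Rightarrow> 'z::comm_monoid_add"
    by (induction xs) (simp_all add: sum_list_addf)
  then show ?thesis by (simp add: sweedler2_def case_prod_unfold)
qed

lemma linear_map_on_mult_const:
  assumes "linear_map_on A (*) f"
  shows "linear_map_on A (*) (\<lambda>x. f x * c)" "linear_map_on A (*) (\<lambda>x. c * f x)"
  using assms by (auto simp: linear_map_on_def algebra_simps)

lemma linear_map_on_cong:
  assumes "module.subspace (smul A) (carrier A)" "module (smul A)"
    and "\<And>x. x \<in> carrier A \<Longrightarrow> f x = g x"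
  shows "linear_map_on A s f \<longleftrightarrow> linear_map_on A s g"
  using assms module.subspace_add[OF assms(2,1)] module.subspace_scale[OF assms(2,1)]
  by (simp add: linear_map_on_def)

text \<open>The list presenting \<open>t\<close> is the same for every \<open>x\<close>, so
  linearity in \<open>x\<close> can be checked summand by summand.\<close>

lemma linear_map_on_sweedler2:
  assumes "t \<in> tensors2 B" "module.subspace (smul A) (carrier A)" "module (smul A)"
    and "\<And>a b. a \<in> carrier B \<Longrightarrow> b \<in> carrier B \<Longrightarrow> linear_map_on A (*) (\<lambda>x. f x a b)"
  shows "linear_map_on A (*) (\<lambda>x. sweedler2 B t (f x))"
proof -
  have "sweedler2 B t (f (x + y)) = sweedler2 B t (\<lambda>a b. f x a b + f y a b)"
    "sweedler2 B t (f (smul A c x)) = sweedler2 B t (\<lambda>a b. c * f x a b)"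
    if "x \<in> carrier A" "y \<in> carrier A" for c x y
    using assms(4) that by (auto intro!: sweedler2_cong[OF assms(1)] simp: linear_map_on_def)
  then show ?thesis
    by (simp add: linear_map_on_def sweedler2_add sweedler2_mult_left)
qed

section \<open>Functionals and tensors on a finite dimensional space\<close>

context fd_space
begin

lemma dual_linear: "\<phi> \<in> dual_set A \<Longrightarrow> linear_map_on A (*) \<phi>"
  by (simp add: dual_set_def linear_map_on_def)

lemma dual_setI:
  assumes "linear_map_on A (*) f"
  shows "(\<lambda>x. if x \<in> carrier A then f x else 0) \<in> dual_set A"
  using assms subspace_add[OF subspace_carrier] subspace_scale[OF subspace_carrier]
  by (auto simp: dual_set_def linear_map_on_def)

lemma dual_ext:
  assumes "\<phi> \<in> dual_set A" "\<psi> \<in> dual_set A" "\<And>x. x \<in> carrier A \<Longrightarrow> \<phi> x = \<psi> x"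
  shows "\<phi> = \<psi>"
proof
  show "\<phi> x = \<psi> x" for x
    using assms by (cases "x \<in> carrier A") (auto simp: dual_set_def)
qed

text \<open>The coefficients supplied by \<open>dual_basis\<close> are themselves functionals, so
  \<open>x\<close> and \<open>y\<close> have the same expansion.\<close>

lemma dual_separates:
  assumes "x \<in> carrier A" "y \<in> carrier A" "\<And>\<phi>. \<phi> \<in> dual_set A \<Longrightarrow> \<phi> x = \<phi> y"
  shows "x = y"
proof -
  obtain B r where B: "\<And>b. b \<in> B \<Longrightarrow> r b \<in> dual_set A"
    "\<And>x. x \<in> carrier A \<Longrightarrow> x = (\<Sum>b\<in>B. r b x \<bullet> b)"
    using dual_basis by metis
  have "x = (\<Sum>b\<in>B. r b x \<bullet> b)" using B(2) assms(1) by blast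
  also have "\<dots> = (\<Sum>b\<in>B. r b y \<bullet> b)" using B(1) assms(3) by (intro sum.cong) auto
  also have "\<dots> = y" using B(2)[OF assms(2)] by simp
  finally show ?thesis .
qed

lemma tensor2_outside:
  assumes "t \<in> tensors2 A" "\<not> (\<phi> \<in> dual_set A \<and> \<psi> \<in> dual_set A)"
  shows "t \<phi> \<psi> = 0"
proof -
  obtain xs where "t = (\<Sum>(x, y)\<leftarrow>xs. x \<otimes> y)"
    using assms(1) by (auto simp: tensors2_def)
  with assms(2) show ?thesis
    by (auto simp: sum_list_fun_apply case_prod_unfold elem2_def)
qed

text \<open>Elementary tensors take the default value 0 unless both arguments are functionals, so
  the values on functionals decide.\<close>

lemma tensor2_eqI:
  assumes "t \<in> tensors2 A" "u \<in> tensors2 A"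
    and "\<And>\<phi> \<psi>. \<phi> \<in> dual_set A \<Longrightarrow> \<psi> \<in> dual_set A \<Longrightarrow> t \<phi> \<psi> = u \<phi> \<psi>"
  shows "t = u"
proof (intro ext)
  show "t \<phi> \<psi> = u \<phi> \<psi>" for \<phi> \<psi>
    using assms(3) tensor2_outside[OF assms(1), of \<phi> \<psi>] tensor2_outside[OF assms(2), of \<phi> \<psi>]
    by (cases "\<phi> \<in> dual_set A \<and> \<psi> \<in> dual_set A") auto
qed

text \<open>Evaluating the chosen presentation of \<open>t\<close> termwise at \<open>\<phi>\<close>
  and \<open>\<psi>\<close> gives exactly the Sweedler sum. Most later computations move between
  these two forms.\<close>

lemma sweedler2_pairing:
  assumes "t \<in> tensors2 A" "\<phi> \<in> dual_set A" "\<psi> \<in> dual_set A"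
  shows "sweedler2 A t (\<lambda>a b. \<phi> a * \<psi> b) = t \<phi> \<psi>"
proof -
  have "t \<phi> \<psi> = (\<Sum>(x, y)\<leftarrow>presentation A t. x \<otimes> y) \<phi> \<psi>"
    by (simp only: presentation_sum[OF assms(1)])
  also have "\<dots> = sweedler2 A t (\<lambda>a b. \<phi> a * \<psi> b)"
    using assms(2,3)
    by (simp add: sum_list_fun_apply case_prod_unfold elem2_def sweedler2_presentation)
  finally show ?thesis by simp
qed

lemma sum_list_closed:
  "(\<And>p. p \<in> set xs \<Longrightarrow> f p \<in> carrier A) \<Longrightarrow> (\<Sum>p\<leftarrow>xs. f p) \<in> carrier A"
  by (induction xs) (auto intro: subspace_0 subspace_add subspace_carrier)

lemma sweedler2_closed:
  assumes "t \<in> tensors2 B" "\<And>a b. a \<in> carrier B \<Longrightarrow> b \<in> carrier B \<Longrightarrow> f a b \<in> carrier A"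
  shows "sweedler2 B t f \<in> carrier A"
  unfolding sweedler2_presentation
  by (rule sum_list_closed) (use presentation_subset[OF assms(1)] assms(2) in auto)

lemma dual_sum_list:
  assumes "\<phi> \<in> dual_set A" "\<And>p. p \<in> set xs \<Longrightarrow> f p \<in> carrier A"
  shows "\<phi> (\<Sum>p\<leftarrow>xs. f p) = (\<Sum>p\<leftarrow>xs. \<phi> (f p))"
  using assms(2)
proof (induction xs)
  case Nil
  have "\<phi> (0 + 0) = \<phi> 0 + \<phi> 0"
    using assms(1) subspace_0[OF subspace_carrier] by (simp only: dual_set_def) blast
  then have "\<phi> 0 = 0" by (simp only: add_0_left add_cancel_right_right)
  then show ?case by simp
next
  case (Cons p xs)
  have "f p \<in> carrier A" "(\<Sum>p\<leftarrow>xs. f p) \<in> carrier A" using Cons by (auto intro: sum_list_closed)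
  with assms(1) have "\<phi> (f p + (\<Sum>p\<leftarrow>xs. f p)) = \<phi> (f p) + \<phi> (\<Sum>p\<leftarrow>xs. f p)"
    by (simp add: dual_set_def)
  with Cons show ?case by simp
qed

lemma dual_sweedler2:
  assumes "\<phi> \<in> dual_set A" "t \<in> tensors2 A"
    and "\<And>a b. a \<in> carrier A \<Longrightarrow> b \<in> carrier A \<Longrightarrow> f a b \<in> carrier A"
  shows "\<phi> (sweedler2 A t f) = sweedler2 A t (\<lambda>a b. \<phi> (f a b))"
proof -
  have "\<phi> (\<Sum>p\<leftarrow>presentation A t. f (fst p) (snd p)) = (\<Sum>p\<leftarrow>presentation A t. \<phi> (f (fst p) (snd p)))"
    using assms(3) presentation_subset[OF assms(2)] by (intro dual_sum_list[OF assms(1)]) auto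
  then show ?thesis by (simp add: sweedler2_presentation case_prod_unfold)
qed

text \<open>Applying \<open>f\<close> and \<open>g\<close> entrywise to the list presenting
  \<open>t\<close> yields a list presenting the new tensor; the first two claims are read off from
  it, and the third evaluates each summand.\<close>

lemma sweedler2_elem2:
  fixes t :: "('k, 'a) tensor2"
  assumes "t \<in> tensors2 A"
    and "\<And>a. a \<in> carrier A \<Longrightarrow> f a \<in> carrier A" "\<And>b. b \<in> carrier A \<Longrightarrow> g b \<in> carrier A"
  shows "sweedler2 A t (\<lambda>a b. f a \<otimes> g b) \<in> tensors2 A"
    and "\<lbrakk>\<And>y. y \<in> carrier A \<Longrightarrow> linear_map_on A (*) (\<lambda>x. h x y);
          \<And>x. x \<in> carrier A \<Longrightarrow> linear_map_on A (*) (\<lambda>y. h x y)\<rbrakk> \<Longrightarrow>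
      sweedler2 A (sweedler2 A t (\<lambda>a b. f a \<otimes> g b)) h = sweedler2 A t (\<lambda>a b. h (f a) (g b))"
    and "\<phi> \<in> dual_set A \<Longrightarrow> \<psi> \<in> dual_set A \<Longrightarrow>
      sweedler2 A t (\<lambda>a b. f a \<otimes> g b) \<phi> \<psi> = sweedler2 A t (\<lambda>a b. \<phi> (f a) * \<psi> (g b))"
proof -
  define ys where "ys = map (\<lambda>(a, b). (f a, g b)) (presentation A t)"
  have ys: "set ys \<subseteq> carrier A \<times> carrier A" using presentation_subset[OF assms(1)] assms(2,3) by (auto simp: ys_def)
  have eq: "sweedler2 A t (\<lambda>a b. f a \<otimes> g b) = (\<Sum>(x, y)\<leftarrow>ys. x \<otimes> y)"
    by (simp add: sweedler2_presentation ys_def case_prod_unfold o_def)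
  with ys show "sweedler2 A t (\<lambda>a b. f a \<otimes> g b) \<in> tensors2 A" by (auto simp: tensors2_def)
  show "sweedler2 A (sweedler2 A t (\<lambda>a b. f a \<otimes> g b)) h = sweedler2 A t (\<lambda>a b. h (f a) (g b))"
    if "\<And>y. y \<in> carrier A \<Longrightarrow> linear_map_on A (*) (\<lambda>x. h x y)"
      "\<And>x. x \<in> carrier A \<Longrightarrow> linear_map_on A (*) (\<lambda>y. h x y)"
    using sweedler2_eq[OF vector_space_mult that ys] unfolding eq
    by (simp add: sweedler2_presentation ys_def case_prod_unfold o_def)
  show "sweedler2 A t (\<lambda>a b. f a \<otimes> g b) \<phi> \<psi> = sweedler2 A t (\<lambda>a b. \<phi> (f a) * \<psi> (g b))"
    if "\<phi> \<in> dual_set A" "\<psi> \<in> dual_set A"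
    using that by (simp add: sweedler2_fun_apply elem2_def)
qed

end


text \<open>Keeps product, unit and coproduct of the dual folded, since they are handled mainly
  through their values on elements of \<open>A\<close>.\<close>

declare dual_simps(3,4,5) [simp del]

text \<open>The standard right action of \<open>a\<close> on functionals,
  \<open>\<phi>(a _)\<close>; the cut-off outside the carrier makes the result a member of
  \<open>dual_set\<close>.\<close>

definition left_translate :: "('k::field, 'a::ab_group_add, 'z) bialg_scheme \<Rightarrow> 'a \<Rightarrow> ('a \<Rightarrow> 'k) \<Rightarrow> 'a \<Rightarrow> 'k" where
  "left_translate A a \<phi> = (\<lambda>x. if x \<in> carrier A then \<phi> (a \<cdot>\<^bsub>A\<^esub> x) else 0)"

text \<open>The standard left action \<open>\<phi>(_ a)\<close>, with the same cut-off.\<close>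

definition right_translate :: "('k::field, 'a::ab_group_add, 'z) bialg_scheme \<Rightarrow> 'a \<Rightarrow> ('a \<Rightarrow> 'k) \<Rightarrow> 'a \<Rightarrow> 'k" where
  "right_translate A a \<phi> = (\<lambda>x. if x \<in> carrier A then \<phi> (x \<cdot>\<^bsub>A\<^esub> a) else 0)"

lemma translate_apply [simp]:
  "x \<in> carrier A \<Longrightarrow> left_translate A a \<phi> x = \<phi> (a \<cdot>\<^bsub>A\<^esub> x)"
  "x \<in> carrier A \<Longrightarrow> right_translate A a \<phi> x = \<phi> (x \<cdot>\<^bsub>A\<^esub> a)"
  by (simp_all add: left_translate_def right_translate_def)

context fd_algebra
begin

lemma linear_mul:
  assumes "\<phi> \<in> dual_set A" "a \<in> carrier A"
  shows "linear_map_on A (*) (\<lambda>x. \<phi> (a \<cdot> x))" "linear_map_on A (*) (\<lambda>x. \<phi> (x \<cdot> a))"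
  using dual_linear[OF assms(1)] mul_linear_left[OF assms(2)] mul_linear_right[OF assms(2)]
    mul_closed assms(2)
  by (auto simp: linear_map_on_def)

lemma translate_dual [simp]:
  assumes "\<phi> \<in> dual_set A" "a \<in> carrier A"
  shows "left_translate A a \<phi> \<in> dual_set A" "right_translate A a \<phi> \<in> dual_set A"
  unfolding left_translate_def right_translate_def by (intro dual_setI linear_mul assms)+

end

section \<open>Contracting coproducts with functionals\<close>

definition base_L :: "('k::field, 'a::ab_group_add, 'z) bialg_scheme \<Rightarrow> ('a \<Rightarrow> 'k) \<Rightarrow> 'a" where
  "base_L A \<phi> = sweedler2 A (\<Delta>\<^bsub>A\<^esub> \<one>\<^bsub>A\<^esub>) (\<lambda>a b. \<phi> a \<bullet>\<^bsub>A\<^esub> b)"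

definition base_R :: "('k::field, 'a::ab_group_add, 'z) bialg_scheme \<Rightarrow> ('a \<Rightarrow> 'k) \<Rightarrow> 'a" where
  "base_R A \<phi> = sweedler2 A (\<Delta>\<^bsub>A\<^esub> \<one>\<^bsub>A\<^esub>) (\<lambda>a b. \<phi> b \<bullet>\<^bsub>A\<^esub> a)"

lemma left_base_image: "left_base A = base_L A ` dual_set A"
  by (auto simp: left_base_def base_L_def)

lemma right_base_image: "right_base A = base_R A ` dual_set A"
  by (auto simp: right_base_def base_R_def)

context weak_bialgebra
begin

lemma unit_comul [simp]: "\<one> \<in> carrier A" "\<Delta> \<one> \<in> tensors2 A"
  by (simp_all add: unit_closed comul_closed)

lemma mul_simps [simp]:
  "x \<in> carrier A \<Longrightarrow> y \<in> carrier A \<Longrightarrow> x \<cdot> y \<in> carrier A"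
  "x \<in> carrier A \<Longrightarrow> \<one> \<cdot> x = x" "x \<in> carrier A \<Longrightarrow> x \<cdot> \<one> = x"
  by (simp_all add: mul_closed unit_left unit_right)

lemma scale_closed [simp]: "x \<in> carrier A \<Longrightarrow> c \<bullet> x \<in> carrier A"
  by (rule subspace_scale[OF subspace_carrier])

lemma dual_scale: "\<phi> \<in> dual_set A \<Longrightarrow> x \<in> carrier A \<Longrightarrow> \<phi> (c \<bullet> x) = c * \<phi> x"
  by (simp add: dual_set_def)

text \<open>The functional \<open>\<psi>\<close> passes through the finite sum and the scalars
  \<open>\<phi> a\<close>, leaving the pairing with \<open>\<Delta> x\<close>.\<close>

lemma contract_left:
  assumes "x \<in> carrier A" "\<phi> \<in> dual_set A" "\<psi> \<in> dual_set A"
  shows "\<psi> (sweedler2 A (\<Delta> x) (\<lambda>a b. \<phi> a \<bullet> b)) = \<Delta> x \<phi> \<psi>"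
proof -
  have "\<psi> (sweedler2 A (\<Delta> x) (\<lambda>a b. \<phi> a \<bullet> b)) = sweedler2 A (\<Delta> x) (\<lambda>a b. \<psi> (\<phi> a \<bullet> b))"
    by (rule dual_sweedler2) (use assms in \<open>auto intro: comul_closed\<close>)
  also have "\<dots> = sweedler2 A (\<Delta> x) (\<lambda>a b. \<phi> a * \<psi> b)"
    by (rule sweedler2_cong) (use assms dual_scale in \<open>auto intro: comul_closed\<close>)
  finally show ?thesis by (simp add: sweedler2_pairing comul_closed assms)
qed

lemma contract_right:
  assumes "x \<in> carrier A" "\<phi> \<in> dual_set A" "\<psi> \<in> dual_set A"
  shows "\<psi> (sweedler2 A (\<Delta> x) (\<lambda>a b. \<phi> b \<bullet> a)) = \<Delta> x \<psi> \<phi>"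
proof -
  have "\<psi> (sweedler2 A (\<Delta> x) (\<lambda>a b. \<phi> b \<bullet> a)) = sweedler2 A (\<Delta> x) (\<lambda>a b. \<psi> (\<phi> b \<bullet> a))"
    by (rule dual_sweedler2) (use assms in \<open>auto intro: comul_closed\<close>)
  also have "\<dots> = sweedler2 A (\<Delta> x) (\<lambda>a b. \<psi> a * \<phi> b)"
    by (rule sweedler2_cong) (simp_all add: assms dual_scale comul_closed mult.commute)
  finally show ?thesis by (simp add: sweedler2_pairing comul_closed assms)
qed

lemma base_closed [simp]: "base_L A \<phi> \<in> carrier A" "base_R A \<phi> \<in> carrier A"
  by (auto simp: base_L_def base_R_def intro!: sweedler2_closed)

text \<open>The case \<open>x = \<one>\<close> of the contractions. Read from right to left, it
  turns a value of \<open>\<Delta> \<one>\<close> into the value of one functional at a base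
  element, which is how base elements enter the later computations.\<close>

lemma dual_base:
  assumes "\<phi> \<in> dual_set A" "\<psi> \<in> dual_set A"
  shows "\<psi> (base_L A \<phi>) = \<Delta> \<one> \<phi> \<psi>" "\<psi> (base_R A \<phi>) = \<Delta> \<one> \<psi> \<phi>"
  unfolding base_L_def base_R_def by (simp_all add: contract_left contract_right assms)

lemma dual_mul_apply:
  assumes "\<phi> \<in> dual_set A" "\<psi> \<in> dual_set A" "x \<in> carrier A"
  shows "(\<phi> \<cdot>\<^bsub>dual A\<^esub> \<psi>) x = \<Delta> x \<phi> \<psi>"
  using assms by (simp add: dual_simps sweedler2_pairing comul_closed)

lemma dual_mul_closed [simp]:
  assumes "\<phi> \<in> dual_set A" "\<psi> \<in> dual_set A"
  shows "\<phi> \<cdot>\<^bsub>dual A\<^esub> \<psi> \<in> dual_set A"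
proof -
  have "\<phi> \<cdot>\<^bsub>dual A\<^esub> \<psi> = (\<lambda>x. if x \<in> carrier A then \<Delta> x \<phi> \<psi> else 0)"
    using dual_mul_apply[OF assms] by (auto simp: dual_simps)
  moreover have "linear_map_on A (*) (\<lambda>x. \<Delta> x \<phi> \<psi>)"
    using comul_linear by (simp add: linear_map_on_def)
  ultimately show ?thesis by (simp add: dual_setI)
qed

lemma
  shows dual_unit_apply: "x \<in> carrier A \<Longrightarrow> \<one>\<^bsub>dual A\<^esub> x = \<epsilon> x"
    and dual_unit_closed [simp]: "\<one>\<^bsub>dual A\<^esub> \<in> dual_set A"
  using dual_setI[OF counit_linear] by (simp_all add: dual_simps)

text \<open>These are the counit axioms paired with \<open>\<phi>\<close>: the unit of the dual
  agrees with \<open>\<epsilon>\<close> on the carrier, and contracting either leg of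
  \<open>\<Delta> x\<close> with it returns \<open>x\<close>.\<close>

lemma counit_pairing:
  assumes "x \<in> carrier A" "\<phi> \<in> dual_set A"
  shows "\<Delta> x \<one>\<^bsub>dual A\<^esub> \<phi> = \<phi> x" "\<Delta> x \<phi> \<one>\<^bsub>dual A\<^esub> = \<phi> x"
proof -
  have "sweedler2 A (\<Delta> x) (\<lambda>a b. \<one>\<^bsub>dual A\<^esub> a \<bullet> b) = x" "sweedler2 A (\<Delta> x) (\<lambda>a b. \<one>\<^bsub>dual A\<^esub> b \<bullet> a) = x"
    using counit_left[OF assms(1)] counit_right[OF assms(1)]
      sweedler2_cong[OF comul_closed[OF assms(1)], of "\<lambda>a b. \<one>\<^bsub>dual A\<^esub> a \<bullet> b" "\<lambda>a b. \<epsilon> a \<bullet> b"]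
      sweedler2_cong[OF comul_closed[OF assms(1)], of "\<lambda>a b. \<one>\<^bsub>dual A\<^esub> b \<bullet> a" "\<lambda>a b. \<epsilon> b \<bullet> a"]
    by (simp_all add: dual_unit_apply)
  then show "\<Delta> x \<one>\<^bsub>dual A\<^esub> \<phi> = \<phi> x" "\<Delta> x \<phi> \<one>\<^bsub>dual A\<^esub> = \<phi> x"
    using contract_left[OF assms(1) dual_unit_closed assms(2)]
      contract_right[OF assms(1) dual_unit_closed assms(2)] by simp_all
qed

section \<open>Multiplicativity of the coproduct, with multiplications moved into
  functionals\<close>

lemma comul_mul_pairing:
  assumes "x \<in> carrier A" "y \<in> carrier A" "\<phi> \<in> dual_set A" "\<psi> \<in> dual_set A"
  shows "\<Delta> (x \<cdot> y) \<phi> \<psi> =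
    sweedler2 A (\<Delta> x) (\<lambda>a b. sweedler2 A (\<Delta> y) (\<lambda>a' b'. \<phi> (a \<cdot> a') * \<psi> (b \<cdot> b')))"
  using assms by (simp add: comul_mul tmul2_def sweedler2_fun_apply elem2_def)

lemma linear_sweedler2:
  assumes "x \<in> carrier A"
    and "\<And>a b. a \<in> carrier A \<Longrightarrow> b \<in> carrier A \<Longrightarrow> linear_map_on A (*) (\<lambda>y. f y a b)"
  shows "linear_map_on A (*) (\<lambda>y. sweedler2 A (\<Delta> x) (f y))"
  by (rule linear_map_on_sweedler2) (use assms comul_closed subspace_carrier module_axioms in auto)

text \<open>
  In the next two lemmas \<open>f\<close> and \<open>g\<close> are multiplications by a fixed element or the identity, on the side
  away from the factor \<open>p\<close>, and \<open>\<phi>'\<close>, \<open>\<psi>'\<close> are the corresponding translates of \<open>\<phi>\<close>, \<open>\<psi>\<close>.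
\<close>

lemma comul_mul_twist_left:
  assumes x: "x \<in> carrier A" and a: "a \<in> carrier A"
    and \<phi>: "\<phi> \<in> dual_set A" "\<psi> \<in> dual_set A" "\<phi>' \<in> dual_set A" "\<psi>' \<in> dual_set A"
    and fg: "\<And>u. u \<in> carrier A \<Longrightarrow> f u \<in> carrier A" "\<And>u. u \<in> carrier A \<Longrightarrow> g u \<in> carrier A"
    and \<Delta>x: "\<Delta> x = sweedler2 A (\<Delta> \<one>) (\<lambda>u v. f u \<otimes> g v)"
    and eq: "\<And>u p. u \<in> carrier A \<Longrightarrow> p \<in> carrier A \<Longrightarrow> \<phi> (f u \<cdot> p) = \<phi>' (u \<cdot> p)"
      "\<And>u p. u \<in> carrier A \<Longrightarrow> p \<in> carrier A \<Longrightarrow> \<psi> (g u \<cdot> p) = \<psi>' (u \<cdot> p)"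
  shows "\<Delta> (x \<cdot> a) \<phi> \<psi> = \<Delta> a \<phi>' \<psi>'"
proof -
  have "\<Delta> (x \<cdot> a) \<phi> \<psi> = sweedler2 A (\<Delta> \<one>) (\<lambda>u v. sweedler2 A (\<Delta> a) (\<lambda>p q. \<phi> (f u \<cdot> p) * \<psi> (g v \<cdot> q)))"
    unfolding comul_mul_pairing[OF x a \<phi>(1,2)] \<Delta>x
    by (rule sweedler2_elem2(2))
      (use fg \<phi> a in \<open>auto intro!: linear_sweedler2 linear_map_on_mult_const linear_mul\<close>)
  also have "\<dots> = sweedler2 A (\<Delta> \<one>) (\<lambda>u v. sweedler2 A (\<Delta> a) (\<lambda>p q. \<phi>' (u \<cdot> p) * \<psi>' (v \<cdot> q)))"
    by (intro sweedler2_cong unit_comul comul_closed a) (simp add: eq)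
  \<comment> \<open>Multiplicativity is read backwards, for the product
    \<open>\<one> \<cdot> a\<close> and the twisted functionals.\<close>
  also have "\<dots> = \<Delta> (\<one> \<cdot> a) \<phi>' \<psi>'"
    by (rule comul_mul_pairing[symmetric]) (use a \<phi> in auto)
  finally show ?thesis using a by simp
qed

lemma comul_mul_twist_right:
  assumes x: "x \<in> carrier A" and a: "a \<in> carrier A"
    and \<phi>: "\<phi> \<in> dual_set A" "\<psi> \<in> dual_set A" "\<phi>' \<in> dual_set A" "\<psi>' \<in> dual_set A"
    and fg: "\<And>u. u \<in> carrier A \<Longrightarrow> f u \<in> carrier A" "\<And>u. u \<in> carrier A \<Longrightarrow> g u \<in> carrier A"
    and \<Delta>x: "\<Delta> x = sweedler2 A (\<Delta> \<one>) (\<lambda>u v. f u \<otimes> g v)"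
    and eq: "\<And>u p. u \<in> carrier A \<Longrightarrow> p \<in> carrier A \<Longrightarrow> \<phi> (p \<cdot> f u) = \<phi>' (p \<cdot> u)"
      "\<And>u p. u \<in> carrier A \<Longrightarrow> p \<in> carrier A \<Longrightarrow> \<psi> (p \<cdot> g u) = \<psi>' (p \<cdot> u)"
  shows "\<Delta> (a \<cdot> x) \<phi> \<psi> = \<Delta> a \<phi>' \<psi>'"
proof -
  \<comment> \<open>The sum over \<open>\<Delta> x\<close> has to be the outer one before its
    expression through \<open>\<Delta> \<one>\<close> can be substituted.\<close>
  have "\<Delta> (a \<cdot> x) \<phi> \<psi> = sweedler2 A (\<Delta> x) (\<lambda>u v. sweedler2 A (\<Delta> a) (\<lambda>p q. \<phi> (p \<cdot> u) * \<psi> (q \<cdot> v)))"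
    unfolding comul_mul_pairing[OF a x \<phi>(1,2)] by (rule sweedler2_swap)
  also have "\<dots> = sweedler2 A (\<Delta> \<one>) (\<lambda>u v. sweedler2 A (\<Delta> a) (\<lambda>p q. \<phi> (p \<cdot> f u) * \<psi> (q \<cdot> g v)))"
    unfolding \<Delta>x
    by (rule sweedler2_elem2(2))
      (use fg \<phi> a in \<open>auto intro!: linear_sweedler2 linear_map_on_mult_const linear_mul\<close>)
  also have "\<dots> = sweedler2 A (\<Delta> \<one>) (\<lambda>u v. sweedler2 A (\<Delta> a) (\<lambda>p q. \<phi>' (p \<cdot> u) * \<psi>' (q \<cdot> v)))"
    by (intro sweedler2_cong unit_comul comul_closed a) (simp add: eq)
  also have "\<dots> = \<Delta> (a \<cdot> \<one>) \<phi>' \<psi>'"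
    by (subst sweedler2_swap, rule comul_mul_pairing[symmetric]) (use a \<phi> in auto)
  finally show ?thesis using a by simp
qed

section \<open>The subspaces \<open>N_LL\<close>, \<open>N_LR\<close>, \<open>N_RL\<close> and
  \<open>N_RR\<close>\<close>

lemma comul_eq_iff:
  assumes b: "b \<in> carrier A"
    and fg: "\<And>u. u \<in> carrier A \<Longrightarrow> f u \<in> carrier A" "\<And>u. u \<in> carrier A \<Longrightarrow> g u \<in> carrier A"
    and FG: "\<And>\<phi>. \<phi> \<in> dual_set A \<Longrightarrow> F \<phi> \<in> dual_set A" "\<And>\<phi>. \<phi> \<in> dual_set A \<Longrightarrow> G \<phi> \<in> dual_set A"
    and eq: "\<And>\<phi> u. \<phi> \<in> dual_set A \<Longrightarrow> u \<in> carrier A \<Longrightarrow> \<phi> (f u) = F \<phi> u"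
      "\<And>\<phi> u. \<phi> \<in> dual_set A \<Longrightarrow> u \<in> carrier A \<Longrightarrow> \<phi> (g u) = G \<phi> u"
  shows "\<Delta> b = sweedler2 A (\<Delta> \<one>) (\<lambda>u v. f u \<otimes> g v) \<longleftrightarrow>
    (\<forall>\<phi>\<in>dual_set A. \<forall>\<psi>\<in>dual_set A. \<Delta> b \<phi> \<psi> = \<Delta> \<one> (F \<phi>) (G \<psi>))" (is "_ = ?t \<longleftrightarrow> _")
proof -
  \<comment> \<open>Once both sides are known to be tensors, comparing pairings suffices;
    \<open>F\<close> and \<open>G\<close> are the transposes of \<open>f\<close> and
    \<open>g\<close>.\<close>
  have t: "?t \<in> tensors2 A" using fg by (intro sweedler2_elem2(1)) auto
  have "?t \<phi> \<psi> = \<Delta> \<one> (F \<phi>) (G \<psi>)" if "\<phi> \<in> dual_set A" "\<psi> \<in> dual_set A" for \<phi> \<psi>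
  proof -
    have "?t \<phi> \<psi> = sweedler2 A (\<Delta> \<one>) (\<lambda>u v. \<phi> (f u) * \<psi> (g v))"
      using fg that by (intro sweedler2_elem2(3)) auto
    also have "\<dots> = sweedler2 A (\<Delta> \<one>) (\<lambda>u v. F \<phi> u * G \<psi> v)"
      by (rule sweedler2_cong) (simp_all add: eq that)
    finally show ?thesis by (simp add: sweedler2_pairing FG that)
  qed
  with tensor2_eqI[OF comul_closed[OF b] t] show ?thesis by metis
qed

text \<open>Multiplication by \<open>b\<close> on one leg is moved into the functional as a
  translate; the remaining value of \<open>\<Delta> \<one>\<close> is, by \<open>dual_base\<close>,
  a functional evaluated at the product of \<open>b\<close> with a base element.\<close>

lemma N_iff:
  "b \<in> N_LL A \<longleftrightarrow> b \<in> carrier A \<and> (\<forall>\<phi>\<in>dual_set A. \<forall>\<psi>\<in>dual_set A. \<Delta> b \<phi> \<psi> = \<phi> (b \<cdot> base_R A \<psi>))"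
  "b \<in> N_LR A \<longleftrightarrow> b \<in> carrier A \<and> (\<forall>\<phi>\<in>dual_set A. \<forall>\<psi>\<in>dual_set A. \<Delta> b \<phi> \<psi> = \<phi> (base_R A \<psi> \<cdot> b))"
  "b \<in> N_RL A \<longleftrightarrow> b \<in> carrier A \<and> (\<forall>\<phi>\<in>dual_set A. \<forall>\<psi>\<in>dual_set A. \<Delta> b \<phi> \<psi> = \<psi> (b \<cdot> base_L A \<phi>))"
  "b \<in> N_RR A \<longleftrightarrow> b \<in> carrier A \<and> (\<forall>\<phi>\<in>dual_set A. \<forall>\<psi>\<in>dual_set A. \<Delta> b \<phi> \<psi> = \<psi> (base_L A \<phi> \<cdot> b))"
proof -
  show "b \<in> N_LL A \<longleftrightarrow> b \<in> carrier A \<and> (\<forall>\<phi>\<in>dual_set A. \<forall>\<psi>\<in>dual_set A. \<Delta> b \<phi> \<psi> = \<phi> (b \<cdot> base_R A \<psi>))"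
    using comul_eq_iff[of b "\<lambda>u. b \<cdot> u" "\<lambda>v. v" "left_translate A b" "\<lambda>\<psi>. \<psi>"]
    by (auto simp: N_LL_def simp flip: dual_base(2))
  show "b \<in> N_LR A \<longleftrightarrow> b \<in> carrier A \<and> (\<forall>\<phi>\<in>dual_set A. \<forall>\<psi>\<in>dual_set A. \<Delta> b \<phi> \<psi> = \<phi> (base_R A \<psi> \<cdot> b))"
    using comul_eq_iff[of b "\<lambda>u. u \<cdot> b" "\<lambda>v. v" "right_translate A b" "\<lambda>\<psi>. \<psi>"]
    by (auto simp: N_LR_def simp flip: dual_base(2))
  show "b \<in> N_RL A \<longleftrightarrow> b \<in> carrier A \<and> (\<forall>\<phi>\<in>dual_set A. \<forall>\<psi>\<in>dual_set A. \<Delta> b \<phi> \<psi> = \<psi> (b \<cdot> base_L A \<phi>))"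
    using comul_eq_iff[of b "\<lambda>u. u" "\<lambda>v. b \<cdot> v" "\<lambda>\<phi>. \<phi>" "left_translate A b"]
    by (auto simp: N_RL_def simp flip: dual_base(1))
  show "b \<in> N_RR A \<longleftrightarrow> b \<in> carrier A \<and> (\<forall>\<phi>\<in>dual_set A. \<forall>\<psi>\<in>dual_set A. \<Delta> b \<phi> \<psi> = \<psi> (base_L A \<phi> \<cdot> b))"
    using comul_eq_iff[of b "\<lambda>u. u" "\<lambda>v. v \<cdot> b" "\<lambda>\<phi>. \<phi>" "right_translate A b"]
    by (auto simp: N_RR_def simp flip: dual_base(1))
qed

lemma N_carrier: "N_LL A \<subseteq> carrier A" "N_LR A \<subseteq> carrier A" "N_RL A \<subseteq> carrier A" "N_RR A \<subseteq> carrier A"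
  by (auto simp: N_LL_def N_LR_def N_RL_def N_RR_def)

text \<open>For \<open>N_LL\<close> one has
  \<open>\<Delta>(b) = (b \<otimes> 1) \<Delta>(1)\<close>, hence \<open>\<Delta>(b a) = (b
  \<otimes> 1) \<Delta>(1) \<Delta>(a) = (b \<otimes> 1) \<Delta>(a)\<close>. The other cases change
  the leg or the side of the multiplication.\<close>

lemma comul_N:
  assumes "a \<in> carrier A" "\<phi> \<in> dual_set A" "\<psi> \<in> dual_set A"
  shows "b \<in> N_LL A \<Longrightarrow> \<Delta> (b \<cdot> a) \<phi> \<psi> = \<Delta> a (left_translate A b \<phi>) \<psi>"
    and "b \<in> N_LR A \<Longrightarrow> \<Delta> (a \<cdot> b) \<phi> \<psi> = \<Delta> a (right_translate A b \<phi>) \<psi>"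
    and "b \<in> N_RL A \<Longrightarrow> \<Delta> (b \<cdot> a) \<phi> \<psi> = \<Delta> a \<phi> (left_translate A b \<psi>)"
    and "b \<in> N_RR A \<Longrightarrow> \<Delta> (a \<cdot> b) \<phi> \<psi> = \<Delta> a \<phi> (right_translate A b \<psi>)"
proof -
  show "\<Delta> (b \<cdot> a) \<phi> \<psi> = \<Delta> a (left_translate A b \<phi>) \<psi>" if "b \<in> N_LL A"
    by (rule comul_mul_twist_left[where f = "\<lambda>u. b \<cdot> u" and g = "\<lambda>v. v"])
      (use assms that in \<open>auto simp: N_LL_def mul_assoc\<close>)
  show "\<Delta> (a \<cdot> b) \<phi> \<psi> = \<Delta> a (right_translate A b \<phi>) \<psi>" if "b \<in> N_LR A"
    by (rule comul_mul_twist_right[where f = "\<lambda>u. u \<cdot> b" and g = "\<lambda>v. v"])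
      (use assms that in \<open>auto simp: N_LR_def mul_assoc\<close>)
  show "\<Delta> (b \<cdot> a) \<phi> \<psi> = \<Delta> a \<phi> (left_translate A b \<psi>)" if "b \<in> N_RL A"
    by (rule comul_mul_twist_left[where f = "\<lambda>u. u" and g = "\<lambda>v. b \<cdot> v"])
      (use assms that in \<open>auto simp: N_RL_def mul_assoc\<close>)
  show "\<Delta> (a \<cdot> b) \<phi> \<psi> = \<Delta> a \<phi> (right_translate A b \<psi>)" if "b \<in> N_RR A"
    by (rule comul_mul_twist_right[where f = "\<lambda>u. u" and g = "\<lambda>v. v \<cdot> b"])
      (use assms that in \<open>auto simp: N_RR_def mul_assoc\<close>)
qed

text \<open>Applying \<open>\<epsilon>\<close> to the first leg of
  \<open>\<Delta>(b) = b 1\<^sub>1 \<otimes> 1\<^sub>2\<close> gives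
  \<open>b = \<epsilon>(b 1\<^sub>1) 1\<^sub>2\<close>, so the functional
  \<open>\<epsilon>(b _)\<close> exhibits \<open>b\<close> as a base element.\<close>

lemma N_LL_subset_left_base: "N_LL A \<subseteq> left_base A"
proof
  fix b assume b: "b \<in> N_LL A"
  then have bc: "b \<in> carrier A" using N_carrier by auto
  have "b = base_L A (left_translate A b \<one>\<^bsub>dual A\<^esub>)"
  proof (rule dual_separates[OF bc base_closed(1)])
    fix \<psi> assume \<psi>: "\<psi> \<in> dual_set A"
    with comul_N(1)[OF unit_comul(1) dual_unit_closed \<psi> b] bc
    show "\<psi> b = \<psi> (base_L A (left_translate A b \<one>\<^bsub>dual A\<^esub>))"
      by (simp add: dual_base counit_pairing)
  qed
  then show "b \<in> left_base A" using bc unfolding left_base_image by (metis imageI translate_dual(1) dual_unit_closed)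
qed

text \<open>Here \<open>\<epsilon>\<close> is applied to the second leg, giving
  \<open>b = 1\<^sub>1 \<epsilon>(b 1\<^sub>2)\<close>.\<close>

lemma N_RL_subset_right_base: "N_RL A \<subseteq> right_base A"
proof
  fix b assume b: "b \<in> N_RL A"
  then have bc: "b \<in> carrier A" using N_carrier by auto
  have "b = base_R A (left_translate A b \<one>\<^bsub>dual A\<^esub>)"
  proof (rule dual_separates[OF bc base_closed(2)])
    fix \<psi> assume \<psi>: "\<psi> \<in> dual_set A"
    with comul_N(3)[OF unit_comul(1) \<psi> dual_unit_closed b] bc
    show "\<psi> b = \<psi> (base_R A (left_translate A b \<one>\<^bsub>dual A\<^esub>))"
      by (simp add: dual_base counit_pairing)
  qed
  then show "b \<in> right_base A" using bc unfolding right_base_image by (metis imageI translate_dual(1) dual_unit_closed)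
qed

section \<open>Comonoidality\<close>

text \<open>Inserting \<open>\<one>\<close> into a list presenting \<open>\<Delta> \<one>\<close>
  presents the triple tensor, and trilinearity of \<open>f\<close> allows this list to replace the
  one chosen by \<open>sweedler3\<close>.\<close>

lemma sweedler3_comul_one:
  assumes "\<And>y z. y \<in> carrier A \<Longrightarrow> z \<in> carrier A \<Longrightarrow> linear_map_on A (*) (\<lambda>x. f x y z)"
    "\<And>x z. x \<in> carrier A \<Longrightarrow> z \<in> carrier A \<Longrightarrow> linear_map_on A (*) (\<lambda>y. f x y z)"
    "\<And>x y. x \<in> carrier A \<Longrightarrow> y \<in> carrier A \<Longrightarrow> linear_map_on A (*) (\<lambda>z. f x y z)"
  shows "sweedler3 A (comul_one_left A) f = sweedler2 A (\<Delta> \<one>) (\<lambda>a b. f a b \<one>)"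
    "sweedler3 A (comul_one_right A) f = sweedler2 A (\<Delta> \<one>) (\<lambda>a b. f \<one> a b)"
proof -
  let ?xs = "presentation A (\<Delta> \<one>)"
  have sub: "set (map (\<lambda>(a, b). (a, b, \<one>)) ?xs) \<subseteq> carrier A \<times> carrier A \<times> carrier A"
    "set (map (\<lambda>(a, b). (\<one>, a, b)) ?xs) \<subseteq> carrier A \<times> carrier A \<times> carrier A"
    using presentation_subset[OF unit_comul(2)] by auto
  show "sweedler3 A (comul_one_left A) f = sweedler2 A (\<Delta> \<one>) (\<lambda>a b. f a b \<one>)"
    using sweedler3_eq[OF vector_space_mult assms sub(1)]
    by (simp add: comul_one_left_def sweedler2_presentation case_prod_unfold o_def)
  show "sweedler3 A (comul_one_right A) f = sweedler2 A (\<Delta> \<one>) (\<lambda>a b. f \<one> a b)"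
    using sweedler3_eq[OF vector_space_mult assms sub(2)]
    by (simp add: comul_one_right_def sweedler2_presentation case_prod_unfold o_def)
qed

lemma linear_mul3:
  assumes "\<phi> \<in> dual_set A" "\<psi> \<in> dual_set A" "\<chi> \<in> dual_set A"
    "a \<in> carrier A" "b \<in> carrier A" "c \<in> carrier A"
  shows "linear_map_on A (*) (\<lambda>x. \<phi> (a \<cdot> x) * \<psi> y * \<chi> z)"
    "linear_map_on A (*) (\<lambda>x. \<phi> y * \<psi> (b \<cdot> x) * \<chi> z)"
    "linear_map_on A (*) (\<lambda>x. \<phi> y * \<psi> z * \<chi> (c \<cdot> x))"
    "linear_map_on A (*) (\<lambda>x. \<phi> (x \<cdot> a) * \<psi> y * \<chi> z)"
    "linear_map_on A (*) (\<lambda>x. \<phi> y * \<psi> (x \<cdot> b) * \<chi> z)"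
    "linear_map_on A (*) (\<lambda>x. \<phi> y * \<psi> z * \<chi> (x \<cdot> c))"
  by (intro linear_map_on_mult_const linear_mul assms)+

text \<open>In either product the two copies of \<open>\<Delta> \<one>\<close> overlap only in the
  middle leg. Pairing the outer legs with \<open>\<phi>\<close> and \<open>\<chi>\<close> collapses
  the copies to base elements, and their order in the middle leg is that of the two factors.\<close>

lemma tmul3_comul_one:
  assumes \<phi>: "\<phi> \<in> dual_set A" "\<psi> \<in> dual_set A" "\<chi> \<in> dual_set A"
  shows "tmul3 A (comul_one_left A) (comul_one_right A) \<phi> \<psi> \<chi> = \<psi> (base_L A \<phi> \<cdot> base_R A \<chi>)"
    and "tmul3 A (comul_one_right A) (comul_one_left A) \<phi> \<psi> \<chi> = \<psi> (base_R A \<chi> \<cdot> base_L A \<phi>)"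
proof -
  let ?m = "\<lambda>a b c a' b' c'. \<phi> (a \<cdot> a') * \<psi> (b \<cdot> b') * \<chi> (c \<cdot> c')"
  have R: "sweedler3 A (comul_one_right A) (?m a b c) =
      sweedler2 A (\<Delta> \<one>) (\<lambda>a' b'. ?m a b c \<one> a' b')"
    if "a \<in> carrier A" "b \<in> carrier A" "c \<in> carrier A" for a b c
    by (intro sweedler3_comul_one linear_mul3 \<phi> that)
  have L: "sweedler3 A (comul_one_left A) (?m a b c) =
      sweedler2 A (\<Delta> \<one>) (\<lambda>a' b'. ?m a b c a' b' \<one>)"
    if "a \<in> carrier A" "b \<in> carrier A" "c \<in> carrier A" for a b c
    by (intro sweedler3_comul_one linear_mul3 \<phi> that)
  \<comment> \<open>\<open>R\<close> and \<open>L\<close> rewrite the inner sums only at carrier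
    elements; linearity of the outer summand is therefore checked on a function that agrees with it
    there.\<close>
  note lin_cong = linear_map_on_cong[OF subspace_carrier module_axioms]
  have "tmul3 A (comul_one_left A) (comul_one_right A) \<phi> \<psi> \<chi> =
      sweedler3 A (comul_one_left A) (\<lambda>a b c. sweedler3 A (comul_one_right A) (?m a b c))"
    using \<phi> by (simp add: tmul3_def sweedler3_fun_apply elem3_def)
  also have "\<dots> = sweedler2 A (\<Delta> \<one>) (\<lambda>a b. sweedler3 A (comul_one_right A) (?m a b \<one>))"
    by (intro sweedler3_comul_one; subst lin_cong, rule R)
      (auto intro!: linear_sweedler2 linear_mul3 \<phi>)
  also have "\<dots> = sweedler2 A (\<Delta> \<one>) (\<lambda>a b. \<phi> a * \<psi> (b \<cdot> base_R A \<chi>))"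
  proof (intro sweedler2_cong unit_comul)
    fix a b assume ab: "a \<in> carrier A" "b \<in> carrier A"
    have "sweedler3 A (comul_one_right A) (?m a b \<one>) =
        sweedler2 A (\<Delta> \<one>) (\<lambda>a' b'. \<phi> a * (left_translate A b \<psi> a' * \<chi> b'))"
      unfolding R[OF ab unit_closed] by (rule sweedler2_cong) (use ab in \<open>auto simp: mult.assoc\<close>)
    also have "\<dots> = \<phi> a * \<psi> (b \<cdot> base_R A \<chi>)"
      using ab \<phi> by (simp add: sweedler2_mult_left sweedler2_pairing flip: dual_base(2))
    finally show "sweedler3 A (comul_one_right A) (?m a b \<one>) = \<phi> a * \<psi> (b \<cdot> base_R A \<chi>)" .
  qed
  \<comment> \<open>The second copy of \<open>\<Delta> \<one>\<close> is contracted; writing its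
    result as a translate of \<open>\<psi>\<close> puts the first copy in the form of a
    pairing.\<close>
  also have "\<dots> = sweedler2 A (\<Delta> \<one>) (\<lambda>a b. \<phi> a * right_translate A (base_R A \<chi>) \<psi> b)"
    by (rule sweedler2_cong) auto
  also have "\<dots> = \<psi> (base_L A \<phi> \<cdot> base_R A \<chi>)"
    using \<phi> by (simp add: sweedler2_pairing flip: dual_base(1))
  finally show "tmul3 A (comul_one_left A) (comul_one_right A) \<phi> \<psi> \<chi> = \<psi> (base_L A \<phi> \<cdot> base_R A \<chi>)" .
  have "tmul3 A (comul_one_right A) (comul_one_left A) \<phi> \<psi> \<chi> =
      sweedler3 A (comul_one_right A) (\<lambda>a b c. sweedler3 A (comul_one_left A) (?m a b c))"
    using \<phi> by (simp add: tmul3_def sweedler3_fun_apply elem3_def)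
  also have "\<dots> = sweedler2 A (\<Delta> \<one>) (\<lambda>a b. sweedler3 A (comul_one_left A) (?m \<one> a b))"
    by (intro sweedler3_comul_one; subst lin_cong, rule L)
      (auto intro!: linear_sweedler2 linear_mul3 \<phi>)
  also have "\<dots> = sweedler2 A (\<Delta> \<one>) (\<lambda>a b. \<psi> (a \<cdot> base_L A \<phi>) * \<chi> b)"
  proof (intro sweedler2_cong unit_comul)
    fix a b assume ab: "a \<in> carrier A" "b \<in> carrier A"
    have "sweedler3 A (comul_one_left A) (?m \<one> a b) =
        sweedler2 A (\<Delta> \<one>) (\<lambda>a' b'. \<phi> a' * left_translate A a \<psi> b' * \<chi> b)"
      unfolding L[OF unit_closed ab] by (rule sweedler2_cong) (use ab in auto)
    also have "\<dots> = \<psi> (a \<cdot> base_L A \<phi>) * \<chi> b"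
      using ab \<phi> by (simp add: sweedler2_mult_right sweedler2_pairing flip: dual_base(1))
    finally show "sweedler3 A (comul_one_left A) (?m \<one> a b) = \<psi> (a \<cdot> base_L A \<phi>) * \<chi> b" .
  qed
  also have "\<dots> = sweedler2 A (\<Delta> \<one>) (\<lambda>a b. right_translate A (base_L A \<phi>) \<psi> a * \<chi> b)"
    by (rule sweedler2_cong) auto
  also have "\<dots> = \<psi> (base_R A \<chi> \<cdot> base_L A \<phi>)"
    using \<phi> by (simp add: sweedler2_pairing flip: dual_base(2))
  finally show "tmul3 A (comul_one_right A) (comul_one_left A) \<phi> \<psi> \<chi> = \<psi> (base_R A \<chi> \<cdot> base_L A \<phi>)" .
qed

text \<open>Pairing a coproduct with two functionals is evaluation of their product in the dual.
  Splitting the second leg of \<open>\<Delta> \<one>\<close>, by coassociativity, leaves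
  \<open>\<phi>\<close> to contract the first; splitting the first leg leaves \<open>\<chi>\<close>
  to contract the second.\<close>

lemma comul2_one_pairing:
  assumes \<phi>: "\<phi> \<in> dual_set A" "\<psi> \<in> dual_set A" "\<chi> \<in> dual_set A"
  shows "comul2_one A \<phi> \<psi> \<chi> = \<Delta> (base_L A \<phi>) \<psi> \<chi>"
    and "comul2_one A \<phi> \<psi> \<chi> = \<Delta> (base_R A \<chi>) \<phi> \<psi>"
proof -
  have "comul2_one A \<phi> \<psi> \<chi> = sweedler2 A (\<Delta> \<one>) (\<lambda>a b. sweedler2 A (\<Delta> b) (\<lambda>b' b''. \<phi> a * \<psi> b' * \<chi> b''))"
    unfolding comul2_one_def coassoc[OF unit_closed] using \<phi> by (simp add: sweedler2_fun_apply elem3_def)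
  also have "\<dots> = sweedler2 A (\<Delta> \<one>) (\<lambda>a b. \<phi> a * (\<psi> \<cdot>\<^bsub>dual A\<^esub> \<chi>) b)"
    by (rule sweedler2_cong)
      (use \<phi> in \<open>auto simp: mult.assoc sweedler2_mult_left sweedler2_pairing comul_closed dual_mul_apply\<close>)
  also have "\<dots> = (\<psi> \<cdot>\<^bsub>dual A\<^esub> \<chi>) (base_L A \<phi>)"
    using \<phi> by (simp add: sweedler2_pairing dual_base)
  finally show "comul2_one A \<phi> \<psi> \<chi> = \<Delta> (base_L A \<phi>) \<psi> \<chi>" using \<phi> by (simp add: dual_mul_apply)
  have "comul2_one A \<phi> \<psi> \<chi> = sweedler2 A (\<Delta> \<one>) (\<lambda>a b. sweedler2 A (\<Delta> a) (\<lambda>a' a''. \<phi> a' * \<psi> a'' * \<chi> b))"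
    using \<phi> by (simp add: comul2_one_def sweedler2_fun_apply elem3_def)
  also have "\<dots> = sweedler2 A (\<Delta> \<one>) (\<lambda>a b. (\<phi> \<cdot>\<^bsub>dual A\<^esub> \<psi>) a * \<chi> b)"
    by (rule sweedler2_cong)
      (use \<phi> in \<open>auto simp: sweedler2_mult_right sweedler2_pairing comul_closed dual_mul_apply\<close>)
  also have "\<dots> = (\<phi> \<cdot>\<^bsub>dual A\<^esub> \<psi>) (base_R A \<chi>)"
    using \<phi> by (simp add: sweedler2_pairing dual_base)
  finally show "comul2_one A \<phi> \<psi> \<chi> = \<Delta> (base_R A \<chi>) \<phi> \<psi>" using \<phi> by (simp add: dual_mul_apply)
qed

lemma tensor3_outside:
  assumes "\<not> (\<phi> \<in> dual_set A \<and> \<psi> \<in> dual_set A \<and> \<chi> \<in> dual_set A)"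
  shows "tmul3 A t u \<phi> \<psi> \<chi> = 0" "comul2_one A \<phi> \<psi> \<chi> = 0"
proof -
  have "(x \<otimes> y \<otimes> z) \<phi> \<psi> \<chi> = 0" for x y z
    unfolding elem3_def using assms by (rule if_not_P)
  then show "tmul3 A t u \<phi> \<psi> \<chi> = 0" "comul2_one A \<phi> \<psi> \<chi> = 0"
    by (simp_all add: tmul3_def comul2_one_def sweedler2_fun_apply sweedler3_fun_apply)
qed

text \<open>All the tensors involved vanish when an argument is not a functional, so each axiom can
  be tested on triples of functionals.\<close>

lemma comonoidal_iff:
  "left_comonoidal A \<longleftrightarrow> (\<forall>\<phi>\<in>dual_set A. \<forall>\<psi>\<in>dual_set A. \<forall>\<chi>\<in>dual_set A.
     \<psi> (base_L A \<phi> \<cdot> base_R A \<chi>) = comul2_one A \<phi> \<psi> \<chi>)"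
  "right_comonoidal A \<longleftrightarrow> (\<forall>\<phi>\<in>dual_set A. \<forall>\<psi>\<in>dual_set A. \<forall>\<chi>\<in>dual_set A.
     \<psi> (base_R A \<chi> \<cdot> base_L A \<phi>) = comul2_one A \<phi> \<psi> \<chi>)"
proof -
  have eq: "tmul3 A t u = comul2_one A \<longleftrightarrow> (\<forall>\<phi>\<in>dual_set A. \<forall>\<psi>\<in>dual_set A. \<forall>\<chi>\<in>dual_set A.
      tmul3 A t u \<phi> \<psi> \<chi> = comul2_one A \<phi> \<psi> \<chi>)" for t u
    
  proof (rule iffI)
    assume *: "\<forall>\<phi>\<in>dual_set A. \<forall>\<psi>\<in>dual_set A. \<forall>\<chi>\<in>dual_set A.
      tmul3 A t u \<phi> \<psi> \<chi> = comul2_one A \<phi> \<psi> \<chi>"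
    show "tmul3 A t u = comul2_one A"
    proof (intro ext)
      show "tmul3 A t u \<phi> \<psi> \<chi> = comul2_one A \<phi> \<psi> \<chi>" for \<phi> \<psi> \<chi>
        using * tensor3_outside[of \<phi> \<psi> \<chi>]
        by (cases "\<phi> \<in> dual_set A \<and> \<psi> \<in> dual_set A \<and> \<chi> \<in> dual_set A") auto
    qed
  qed simp
  show "left_comonoidal A \<longleftrightarrow> (\<forall>\<phi>\<in>dual_set A. \<forall>\<psi>\<in>dual_set A. \<forall>\<chi>\<in>dual_set A.
     \<psi> (base_L A \<phi> \<cdot> base_R A \<chi>) = comul2_one A \<phi> \<psi> \<chi>)"
    "right_comonoidal A \<longleftrightarrow> (\<forall>\<phi>\<in>dual_set A. \<forall>\<psi>\<in>dual_set A. \<forall>\<chi>\<in>dual_set A.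
     \<psi> (base_R A \<chi> \<cdot> base_L A \<phi>) = comul2_one A \<phi> \<psi> \<chi>)"
    unfolding left_comonoidal_def right_comonoidal_def eq by (simp_all add: tmul3_comul_one)
qed

text \<open>Functionals separate points, so commutation takes the same scalar form as the
  comonoidality axioms.\<close>

lemma commuting_iff:
  "commuting A (left_base A) (right_base A) \<longleftrightarrow>
    (\<forall>\<phi>\<in>dual_set A. \<forall>\<psi>\<in>dual_set A. \<forall>\<chi>\<in>dual_set A.
      \<psi> (base_L A \<phi> \<cdot> base_R A \<chi>) = \<psi> (base_R A \<chi> \<cdot> base_L A \<phi>))"
  unfolding commuting_def left_base_image right_base_image
  unfolding ball_simps(9) image_iff
  by (metis dual_separates base_closed mul_closed)

text \<open>Left-comonoidality, right-comonoidality and commutation each equate two of the three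
  scalars \<open>\<psi> (base_L A \<phi> \<cdot> base_R A \<chi>)\<close>,
  \<open>\<psi> (base_R A \<chi> \<cdot> base_L A \<phi>)\<close> and
  \<open>comul2_one A \<phi> \<psi> \<chi>\<close>; any two of these equations imply the
  third.\<close>

lemma comonoidal_equivalences:
  "comonoidal A \<longleftrightarrow> left_comonoidal A \<and> commuting A (left_base A) (right_base A)"
  "comonoidal A \<longleftrightarrow> right_comonoidal A \<and> commuting A (left_base A) (right_base A)"
  unfolding comonoidal_def comonoidal_iff commuting_iff by - (intro iffI conjI ballI; metis)+

text \<open>Left-comonoidality puts the bases into \<open>N_LL\<close> and \<open>N_RR\<close>,
  right-comonoidality into \<open>N_LR\<close> and \<open>N_RL\<close>. The reverse inclusions come
  from the counit.\<close>

lemma comonoidal_bases: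
  assumes "comonoidal A"
  shows "left_base A = N_LL A" "left_base A \<subseteq> N_LR A" "right_base A = N_RL A" "right_base A \<subseteq> N_RR A"
proof -
  have com: "\<psi> (base_L A \<phi> \<cdot> base_R A \<chi>) = comul2_one A \<phi> \<psi> \<chi>"
    "\<psi> (base_R A \<chi> \<cdot> base_L A \<phi>) = comul2_one A \<phi> \<psi> \<chi>"
    if "\<phi> \<in> dual_set A" "\<psi> \<in> dual_set A" "\<chi> \<in> dual_set A" for \<phi> \<psi> \<chi>
    using assms that unfolding comonoidal_def comonoidal_iff by blast+
  have "left_base A \<subseteq> N_LL A" "left_base A \<subseteq> N_LR A"
    unfolding left_base_image by (auto simp: N_iff com comul2_one_pairing(1))
  moreover have "right_base A \<subseteq> N_RL A" "right_base A \<subseteq> N_RR A"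
    unfolding right_base_image by (auto simp: N_iff com comul2_one_pairing(2))
  ultimately show "left_base A = N_LL A" "left_base A \<subseteq> N_LR A" "right_base A = N_RL A" "right_base A \<subseteq> N_RR A"
    using N_LL_subset_left_base N_RL_subset_right_base by auto
qed

text \<open>The defining equations are linear in the element, and products are handled by
  \<open>comul_N\<close>: for \<open>N_LL\<close>, \<open>\<Delta>(x y) = (x \<otimes> 1)
  \<Delta>(y) = (x y \<otimes> 1) \<Delta>(1)\<close>.\<close>

lemma subalgebra_N: "subalgebra A (N_LL A)" "subalgebra A (N_RL A)"
proof -
  have add: "(x + y) \<cdot> z = x \<cdot> z + y \<cdot> z" if "x \<in> carrier A" "y \<in> carrier A" "z \<in> carrier A" for x y z
    using mul_linear_left[of z] that by (simp add: linear_map_on_def)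
  have scale: "(c \<bullet> x) \<cdot> z = c \<bullet> (x \<cdot> z)" if "x \<in> carrier A" "z \<in> carrier A" for c x z
    using mul_linear_left[of z] that by (simp add: linear_map_on_def)
  have \<Delta>: "\<Delta> (x + y) \<phi> \<psi> = \<Delta> x \<phi> \<psi> + \<Delta> y \<phi> \<psi>" "\<Delta> (c \<bullet> x) \<phi> \<psi> = c * \<Delta> x \<phi> \<psi>"
    if "x \<in> carrier A" "y \<in> carrier A" for c x y \<phi> \<psi>
    using comul_linear that by (auto simp: linear_map_on_def)
  have dual_add: "\<phi> (x + y) = \<phi> x + \<phi> y"
    if "\<phi> \<in> dual_set A" "x \<in> carrier A" "y \<in> carrier A" for \<phi> x y
    using that by (simp add: dual_set_def)
  note simps = add scale \<Delta>(1) \<Delta>(2)[OF _ unit_closed] dual_add dual_scale subspace_add[OF subspace_carrier]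
  have one: "\<one> \<in> N_LL A" "\<one> \<in> N_RL A" by (simp_all add: N_iff dual_base)
  \<comment> \<open>The zero vector is obtained as \<open>0 \<bullet> \<one>\<close>.\<close>
  have sub: "subspace S"
    if "\<one> \<in> S" "\<And>x y. x \<in> S \<Longrightarrow> y \<in> S \<Longrightarrow> x + y \<in> S" "\<And>c x. x \<in> S \<Longrightarrow> c \<bullet> x \<in> S" for S
    using that that(3)[OF that(1), of 0] by (auto simp: subspace_def)
  have "subspace (N_LL A)" "subspace (N_RL A)"
    by (rule sub; use one in \<open>simp add: N_iff simps\<close>)+
  moreover have "x \<cdot> y \<in> N_LL A" if "x \<in> N_LL A" "y \<in> N_LL A" for x y
    using that comul_N(1)[OF _ _ _ that(1)] by (simp add: N_iff mul_assoc)
  moreover have "x \<cdot> y \<in> N_RL A" if "x \<in> N_RL A" "y \<in> N_RL A" for x y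
    using that comul_N(3)[OF _ _ _ that(1)] by (simp add: N_iff mul_assoc)
  ultimately show "subalgebra A (N_LL A)" "subalgebra A (N_RL A)"
    using one N_carrier by (auto simp: subalgebra_def)
qed

lemma C_eq_center_base:
  assumes "comonoidal A"
  shows "C_L A = center A \<inter> left_base A" "C_R A = center A \<inter> right_base A"
  using comonoidal_bases[OF assms] by (auto simp: C_L_def C_R_def)

section \<open>The dual\<close>

text \<open>The product of the dual is the transposed coproduct, so a central functional is one that
  may sit on either leg of every \<open>\<Delta> x\<close>.\<close>

lemma center_dual_iff:
  "\<phi> \<in> center (dual A) \<longleftrightarrow>
    \<phi> \<in> dual_set A \<and> (\<forall>\<psi>\<in>dual_set A. \<forall>x\<in>carrier A. \<Delta> x \<phi> \<psi> = \<Delta> x \<psi> \<phi>)"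
  unfolding center_def by (simp, metis dual_ext dual_mul_apply dual_mul_closed)

text \<open>Existence and uniqueness of the transposed coproduct replace the definite description by
  its defining property.\<close>

lemma dual_comul_eq_iff:
  assumes "\<phi> \<in> dual_set A" "t \<in> tensors2 (dual_space A)"
  shows "\<Delta>\<^bsub>dual A\<^esub> \<phi> = t \<longleftrightarrow> (\<forall>x\<in>carrier A. \<forall>y\<in>carrier A.
    sweedler2 (dual_space A) t (\<lambda>\<psi> \<chi>. \<psi> x * \<chi> y) = \<phi> (x \<cdot> y))"
proof -
  note u = dual_comul_unique[OF assms(1)]
  show ?thesis
    unfolding dual_simps(5) using theI'[OF u] the1_equality[OF u, of t] assms(2) by auto
qed

lemma dual_comul:
  assumes "\<phi> \<in> dual_set A"
  shows dual_comul_closed: "\<Delta>\<^bsub>dual A\<^esub> \<phi> \<in> tensors2 (dual_space A)"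
    and dual_comul_pairing: "x \<in> carrier A \<Longrightarrow> y \<in> carrier A \<Longrightarrow>
      sweedler2 (dual_space A) (\<Delta>\<^bsub>dual A\<^esub> \<phi>) (\<lambda>\<psi> \<chi>. \<psi> x * \<chi> y) = \<phi> (x \<cdot> y)"
  using theI'[OF dual_comul_unique[OF assms]] by (auto simp: dual_simps(5))

text \<open>Pairing the defining equations with \<open>x \<otimes> y\<close> and using that the
  coproduct of the counit is \<open>\<epsilon>(x y)\<close> gives
  \<open>\<phi>(x y) = \<phi>(x\<^sub>1) \<epsilon>(x\<^sub>2 y)\<close> for \<open>N_LL\<close> and
  \<open>\<phi>(x y) = \<phi>(y\<^sub>1) \<epsilon>(x y\<^sub>2)\<close> for
  \<open>N_RL\<close>.\<close>

lemma N_dual_iff: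
  "\<phi> \<in> N_LL (dual A) \<longleftrightarrow> \<phi> \<in> dual_set A \<and>
    (\<forall>x\<in>carrier A. \<forall>y\<in>carrier A. \<phi> (x \<cdot> y) = \<Delta> x \<phi> (right_translate A y \<one>\<^bsub>dual A\<^esub>))"
  "\<phi> \<in> N_RL (dual A) \<longleftrightarrow> \<phi> \<in> dual_set A \<and>
    (\<forall>x\<in>carrier A. \<forall>y\<in>carrier A. \<phi> (x \<cdot> y) = \<Delta> y \<phi> (left_translate A x \<one>\<^bsub>dual A\<^esub>))"
proof -
  interpret D: fd_space "dual_space A" by (rule fd_space_dual)
  let ?E = "\<Delta>\<^bsub>dual A\<^esub> \<one>\<^bsub>dual A\<^esub>"
  note E = dual_comul[OF dual_unit_closed]
  \<comment> \<open>Evaluation at a point is linear in the functional, as required to evaluate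
    Sweedler sums in the dual.\<close>
  have ev: "linear_map_on (dual_space A) (*) (\<lambda>\<psi>. \<psi> x * c)"
    "linear_map_on (dual_space A) (*) (\<lambda>\<psi>. c * \<psi> x)" for x :: 'a and c :: 'k
    by (auto simp: linear_map_on_def algebra_simps)
  have L: "sweedler2 (dual_space A) ?E (\<lambda>u v. (\<phi> \<cdot>\<^bsub>dual A\<^esub> u) \<otimes>\<^bsub>dual_space A\<^esub> v) \<in> tensors2 (dual_space A)"
    "sweedler2 (dual_space A) (sweedler2 (dual_space A) ?E (\<lambda>u v. (\<phi> \<cdot>\<^bsub>dual A\<^esub> u) \<otimes>\<^bsub>dual_space A\<^esub> v))
      (\<lambda>\<psi> \<chi>. \<psi> x * \<chi> y) = \<Delta> x \<phi> (right_translate A y \<one>\<^bsub>dual A\<^esub>)"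
    if "\<phi> \<in> dual_set A" "x \<in> carrier A" "y \<in> carrier A" for x y
  proof -
    show "sweedler2 (dual_space A) ?E (\<lambda>u v. (\<phi> \<cdot>\<^bsub>dual A\<^esub> u) \<otimes>\<^bsub>dual_space A\<^esub> v) \<in> tensors2 (dual_space A)"
      using that by (intro D.sweedler2_elem2(1) E) auto
    have "sweedler2 (dual_space A) (sweedler2 (dual_space A) ?E (\<lambda>u v. (\<phi> \<cdot>\<^bsub>dual A\<^esub> u) \<otimes>\<^bsub>dual_space A\<^esub> v))
        (\<lambda>\<psi> \<chi>. \<psi> x * \<chi> y) = sweedler2 (dual_space A) ?E (\<lambda>u v. (\<phi> \<cdot>\<^bsub>dual A\<^esub> u) x * v y)"
      using that by (intro D.sweedler2_elem2(2) E ev) auto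
    also have "\<dots> = sweedler2 (dual_space A) ?E (\<lambda>u v. sweedler2 A (\<Delta> x) (\<lambda>a b. \<phi> a * (u b * v y)))"
      using that by (simp add: dual_simps(3) mult.assoc flip: sweedler2_mult_right)
    \<comment> \<open>After the interchange the inner sum is the coproduct of the counit at
      \<open>b \<otimes> y\<close>, hence \<open>\<epsilon>(b y)\<close>.\<close>
    also have "\<dots> = sweedler2 A (\<Delta> x) (\<lambda>a b. \<phi> a * sweedler2 (dual_space A) ?E (\<lambda>u v. u b * v y))"
      by (subst sweedler2_swap) (simp add: sweedler2_mult_left)
    also have "\<dots> = sweedler2 A (\<Delta> x) (\<lambda>a b. \<phi> a * right_translate A y \<one>\<^bsub>dual A\<^esub> b)"
      by (rule sweedler2_cong) (use that E in \<open>auto simp: comul_closed\<close>)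
    finally show "sweedler2 (dual_space A) (sweedler2 (dual_space A) ?E (\<lambda>u v. (\<phi> \<cdot>\<^bsub>dual A\<^esub> u) \<otimes>\<^bsub>dual_space A\<^esub> v))
      (\<lambda>\<psi> \<chi>. \<psi> x * \<chi> y) = \<Delta> x \<phi> (right_translate A y \<one>\<^bsub>dual A\<^esub>)"
      using that by (simp add: sweedler2_pairing comul_closed)
  qed
  have R: "sweedler2 (dual_space A) ?E (\<lambda>u v. u \<otimes>\<^bsub>dual_space A\<^esub> (\<phi> \<cdot>\<^bsub>dual A\<^esub> v)) \<in> tensors2 (dual_space A)"
    "sweedler2 (dual_space A) (sweedler2 (dual_space A) ?E (\<lambda>u v. u \<otimes>\<^bsub>dual_space A\<^esub> (\<phi> \<cdot>\<^bsub>dual A\<^esub> v)))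
      (\<lambda>\<psi> \<chi>. \<psi> x * \<chi> y) = \<Delta> y \<phi> (left_translate A x \<one>\<^bsub>dual A\<^esub>)"
    if "\<phi> \<in> dual_set A" "x \<in> carrier A" "y \<in> carrier A" for x y
  proof -
    show "sweedler2 (dual_space A) ?E (\<lambda>u v. u \<otimes>\<^bsub>dual_space A\<^esub> (\<phi> \<cdot>\<^bsub>dual A\<^esub> v)) \<in> tensors2 (dual_space A)"
      using that by (intro D.sweedler2_elem2(1) E) auto
    have "sweedler2 (dual_space A) (sweedler2 (dual_space A) ?E (\<lambda>u v. u \<otimes>\<^bsub>dual_space A\<^esub> (\<phi> \<cdot>\<^bsub>dual A\<^esub> v)))
        (\<lambda>\<psi> \<chi>. \<psi> x * \<chi> y) = sweedler2 (dual_space A) ?E (\<lambda>u v. u x * (\<phi> \<cdot>\<^bsub>dual A\<^esub> v) y)"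
      using that by (intro D.sweedler2_elem2(2) E ev) auto
    also have "\<dots> = sweedler2 (dual_space A) ?E (\<lambda>u v. sweedler2 A (\<Delta> y) (\<lambda>a b. \<phi> a * (u x * v b)))"
      using that by (simp add: dual_simps(3) mult.left_commute flip: sweedler2_mult_left)
    also have "\<dots> = sweedler2 A (\<Delta> y) (\<lambda>a b. \<phi> a * sweedler2 (dual_space A) ?E (\<lambda>u v. u x * v b))"
      by (subst sweedler2_swap) (simp add: sweedler2_mult_left)
    also have "\<dots> = sweedler2 A (\<Delta> y) (\<lambda>a b. \<phi> a * left_translate A x \<one>\<^bsub>dual A\<^esub> b)"
      by (rule sweedler2_cong) (use that E in \<open>auto simp: comul_closed\<close>)
    finally show "sweedler2 (dual_space A) (sweedler2 (dual_space A) ?E (\<lambda>u v. u \<otimes>\<^bsub>dual_space A\<^esub> (\<phi> \<cdot>\<^bsub>dual A\<^esub> v)))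
      (\<lambda>\<psi> \<chi>. \<psi> x * \<chi> y) = \<Delta> y \<phi> (left_translate A x \<one>\<^bsub>dual A\<^esub>)"
      using that by (simp add: sweedler2_pairing comul_closed)
  qed
  show "\<phi> \<in> N_LL (dual A) \<longleftrightarrow> \<phi> \<in> dual_set A \<and>
    (\<forall>x\<in>carrier A. \<forall>y\<in>carrier A. \<phi> (x \<cdot> y) = \<Delta> x \<phi> (right_translate A y \<one>\<^bsub>dual A\<^esub>))"
    using dual_comul_eq_iff[OF _ L(1)[OF _ unit_closed unit_closed]] L(2)
    by (auto simp: N_LL_def dual_same_tensors)
  show "\<phi> \<in> N_RL (dual A) \<longleftrightarrow> \<phi> \<in> dual_set A \<and>
    (\<forall>x\<in>carrier A. \<forall>y\<in>carrier A. \<phi> (x \<cdot> y) = \<Delta> y \<phi> (left_translate A x \<one>\<^bsub>dual A\<^esub>))"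
    using dual_comul_eq_iff[OF _ R(1)[OF _ unit_closed unit_closed]] R(2)
    by (auto simp: N_RL_def dual_same_tensors)
qed

end

section \<open>Isomorphisms of subalgebras\<close>

lemma subalgebra_Int:
  assumes "module (smul A)" "subalgebra A S" "subalgebra A T"
  shows "subalgebra A (S \<inter> T)"
  using assms by (auto simp: subalgebra_def module.subspace_inter)

text \<open>Since \<open>T\<close> is the image of \<open>S\<close> under a unital homomorphism, its
  subalgebra properties are transported from \<open>S\<close>.\<close>

lemma algebras_isoI:
  assumes mod: "module (smul A)" "module (smul B)"
    and S: "subalgebra A S" and f: "bij_betw f S T" and T: "T \<subseteq> carrier B"
    and hom: "\<And>x y. x \<in> S \<Longrightarrow> y \<in> S \<Longrightarrow> f (x + y) = f x + f y"
      "\<And>c x. x \<in> S \<Longrightarrow> f (c \<bullet>\<^bsub>A\<^esub> x) = c \<bullet>\<^bsub>B\<^esub> f x"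
      "\<And>x y. x \<in> S \<Longrightarrow> y \<in> S \<Longrightarrow> f (x \<cdot>\<^bsub>A\<^esub> y) = f x \<cdot>\<^bsub>B\<^esub> f y"
      "f \<one>\<^bsub>A\<^esub> = \<one>\<^bsub>B\<^esub>"
  shows "algebras_iso A S B T"
proof -
  have S': "module.subspace (smul A) S" "\<one>\<^bsub>A\<^esub> \<in> S" "\<And>x y. x \<in> S \<Longrightarrow> y \<in> S \<Longrightarrow> x \<cdot>\<^bsub>A\<^esub> y \<in> S"
    using S by (auto simp: subalgebra_def)
  have im: "T = f ` S" using f by (simp add: bij_betw_def)
  have "0 \<in> S" using module.subspace_0[OF mod(1) S'(1)] .
  \<comment> \<open>Additivity at \<open>0 + 0\<close> forces \<open>f 0 = 0\<close>.\<close>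
  then have "0 \<in> T" using hom(1)[of 0 0] unfolding im by (simp add: image_iff) metis
  moreover have "f x + f y \<in> T" "c \<bullet>\<^bsub>B\<^esub> f x \<in> T" "f x \<cdot>\<^bsub>B\<^esub> f y \<in> T" if "x \<in> S" "y \<in> S" for c x y
    using that module.subspace_add[OF mod(1) S'(1)] module.subspace_scale[OF mod(1) S'(1)] S'(3)
    by (auto simp: im simp flip: hom)
  moreover have "\<one>\<^bsub>B\<^esub> \<in> T" using S'(2) hom(4) by (metis im imageI)
  ultimately have "subalgebra B T"
    using T unfolding subalgebra_def module.subspace_def[OF mod(2)] by (auto simp: im)
  with S f hom show ?thesis unfolding algebras_iso_def by blast
qed

lemma algebras_iso_sym:
  assumes "module (smul A)" "algebras_iso A S B T"
  shows "algebras_iso B T A S"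
proof -
  obtain f where f: "bij_betw f S T"
      "\<forall>x\<in>S. \<forall>y\<in>S. f (x + y) = f x + f y" "\<forall>c. \<forall>x\<in>S. f (c \<bullet>\<^bsub>A\<^esub> x) = c \<bullet>\<^bsub>B\<^esub> f x"
      "\<forall>x\<in>S. \<forall>y\<in>S. f (x \<cdot>\<^bsub>A\<^esub> y) = f x \<cdot>\<^bsub>B\<^esub> f y" "f \<one>\<^bsub>A\<^esub> = \<one>\<^bsub>B\<^esub>"
    and S: "subalgebra A S" "subalgebra B T"
    using assms(2) unfolding algebras_iso_def by blast
  let ?g = "inv_into S f"
  have g: "\<And>y. y \<in> T \<Longrightarrow> ?g y \<in> S" "\<And>y. y \<in> T \<Longrightarrow> f (?g y) = y" "\<And>x. x \<in> S \<Longrightarrow> ?g (f x) = x"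
    using f(1) by (auto simp: bij_betw_def inv_into_into f_inv_into_f)
  have S': "x + y \<in> S" "c \<bullet>\<^bsub>A\<^esub> x \<in> S" "x \<cdot>\<^bsub>A\<^esub> y \<in> S" "\<one>\<^bsub>A\<^esub> \<in> S" if "x \<in> S" "y \<in> S" for c x y
    using that S(1) assms(1) by (auto simp: subalgebra_def module.subspace_add module.subspace_scale)
  have "?g (x + y) = ?g x + ?g y" "?g (c \<bullet>\<^bsub>B\<^esub> x) = c \<bullet>\<^bsub>A\<^esub> ?g x" "?g (x \<cdot>\<^bsub>B\<^esub> y) = ?g x \<cdot>\<^bsub>A\<^esub> ?g y"
    if "x \<in> T" "y \<in> T" for c x y
    using that g S' f(2-4) by metis+
  moreover have "?g \<one>\<^bsub>B\<^esub> = \<one>\<^bsub>A\<^esub>" using g(3) f(5) S(1) by (metis subalgebra_def)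
  ultimately show ?thesis
    using S bij_betw_inv_into[OF f(1)] unfolding algebras_iso_def by blast
qed

lemma algebras_iso_trans:
  assumes "algebras_iso A S B T" "algebras_iso B T C U"
  shows "algebras_iso A S C U"
proof -
  obtain f where f: "bij_betw f S T"
      "\<forall>x\<in>S. \<forall>y\<in>S. f (x + y) = f x + f y" "\<forall>c. \<forall>x\<in>S. f (c \<bullet>\<^bsub>A\<^esub> x) = c \<bullet>\<^bsub>B\<^esub> f x"
      "\<forall>x\<in>S. \<forall>y\<in>S. f (x \<cdot>\<^bsub>A\<^esub> y) = f x \<cdot>\<^bsub>B\<^esub> f y" "f \<one>\<^bsub>A\<^esub> = \<one>\<^bsub>B\<^esub>"
    using assms(1) unfolding algebras_iso_def by blast
  obtain g where g: "bij_betw g T U"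
      "\<forall>x\<in>T. \<forall>y\<in>T. g (x + y) = g x + g y" "\<forall>c. \<forall>x\<in>T. g (c \<bullet>\<^bsub>B\<^esub> x) = c \<bullet>\<^bsub>C\<^esub> g x"
      "\<forall>x\<in>T. \<forall>y\<in>T. g (x \<cdot>\<^bsub>B\<^esub> y) = g x \<cdot>\<^bsub>C\<^esub> g y" "g \<one>\<^bsub>B\<^esub> = \<one>\<^bsub>C\<^esub>"
    using assms(2) unfolding algebras_iso_def by blast
  have "f x \<in> T" if "x \<in> S" for x using f(1) that by (auto simp: bij_betw_def)
  then have "\<exists>h. bij_betw h S U \<and>
       (\<forall>x\<in>S. \<forall>y\<in>S. h (x + y) = h x + h y) \<and>
       (\<forall>c. \<forall>x\<in>S. h (c \<bullet>\<^bsub>A\<^esub> x) = c \<bullet>\<^bsub>C\<^esub> h x) \<and>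
       (\<forall>x\<in>S. \<forall>y\<in>S. h (x \<cdot>\<^bsub>A\<^esub> y) = h x \<cdot>\<^bsub>C\<^esub> h y) \<and>
       h \<one>\<^bsub>A\<^esub> = \<one>\<^bsub>C\<^esub>"
    using f g by (intro exI[of _ "g \<circ> f"]) (simp add: bij_betw_trans[OF f(1) g(1)])
  with assms show ?thesis unfolding algebras_iso_def by blast
qed

section \<open>The intersection of the bases and the dual, in the comonoidal case\<close>

context weak_bialgebra
begin

context
  assumes com: "comonoidal A"
begin

lemma base_Int_N:
  assumes "x \<in> left_base A \<inter> right_base A"
  shows "x \<in> carrier A" "x \<in> N_LL A" "x \<in> N_LR A" "x \<in> N_RL A" "x \<in> N_RR A"
  using assms comonoidal_bases[OF com] N_carrier by auto

text \<open>As \<open>x\<close> lies in all four subspaces, a translate of the counit on either leg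
  can be undone by \<open>comul_N\<close>; for instance
  \<open>\<epsilon>(x a\<^sub>1) \<chi>(a\<^sub>2)\<close> is the pairing of
  \<open>\<Delta>(x a)\<close> with \<open>\<epsilon> \<otimes> \<chi>\<close>, to which the counit
  axiom applies.\<close>

lemma comul_translate_counit:
  assumes "x \<in> left_base A \<inter> right_base A" "a \<in> carrier A" "\<chi> \<in> dual_set A"
  shows "\<Delta> a (left_translate A x \<one>\<^bsub>dual A\<^esub>) \<chi> = \<chi> (x \<cdot> a)"
    "\<Delta> a \<chi> (left_translate A x \<one>\<^bsub>dual A\<^esub>) = \<chi> (x \<cdot> a)"
    "\<Delta> a (right_translate A x \<one>\<^bsub>dual A\<^esub>) \<chi> = \<chi> (a \<cdot> x)"
    "\<Delta> a \<chi> (right_translate A x \<one>\<^bsub>dual A\<^esub>) = \<chi> (a \<cdot> x)"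
  using comul_N[OF assms(2) dual_unit_closed assms(3)] comul_N[OF assms(2,3) dual_unit_closed]
    base_Int_N[OF assms(1)] assms(2,3) by (simp_all flip: comul_N add: counit_pairing)

lemma translate_bij_C_dual:
  "bij_betw (\<lambda>x. left_translate A x \<one>\<^bsub>dual A\<^esub>) (left_base A \<inter> right_base A) (C_L (dual A))"
  "bij_betw (\<lambda>x. right_translate A x \<one>\<^bsub>dual A\<^esub>) (left_base A \<inter> right_base A) (C_R (dual A))"
proof -
  let ?S = "left_base A \<inter> right_base A"
  \<comment> \<open>At \<open>a = \<one>\<close> the contraction formula recovers every value
    \<open>\<chi> x\<close> from the translate, so the translate determines
    \<open>x\<close>.\<close>
  have inj: "inj_on (\<lambda>x. left_translate A x \<one>\<^bsub>dual A\<^esub>) ?S" "inj_on (\<lambda>x. right_translate A x \<one>\<^bsub>dual A\<^esub>) ?S"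
  proof -
    show "inj_on (\<lambda>x. left_translate A x \<one>\<^bsub>dual A\<^esub>) ?S"
      using comul_translate_counit(1)[OF _ unit_closed] base_Int_N(1)
      by (intro inj_onI dual_separates) (auto, metis IntI mul_simps(3))
    show "inj_on (\<lambda>x. right_translate A x \<one>\<^bsub>dual A\<^esub>) ?S"
      using comul_translate_counit(3)[OF _ unit_closed] base_Int_N(1)
      by (intro inj_onI dual_separates) (auto, metis IntI mul_simps(2))
  qed
  \<comment> \<open>Equality of the contractions on the two legs is centrality; the
    \<open>N_LL\<close> and \<open>N_RL\<close> conditions are these formulas for
    \<open>\<chi>\<close> a translate of the counit.\<close>
  have into: "left_translate A x \<one>\<^bsub>dual A\<^esub> \<in> C_L (dual A)" "right_translate A x \<one>\<^bsub>dual A\<^esub> \<in> C_R (dual A)"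
    if "x \<in> ?S" for x
    using comul_translate_counit[OF that] base_Int_N(1)[OF that]
    by (auto simp: C_L_def C_R_def center_dual_iff N_dual_iff mul_assoc)
  have base: "base_L A \<phi> \<in> ?S" if "\<phi> \<in> center (dual A)" for \<phi>
  proof -
    have \<phi>: "\<phi> \<in> dual_set A" using that by (simp add: center_dual_iff)
    have "base_L A \<phi> = base_R A \<phi>"
      by (rule dual_separates) (use that in \<open>auto simp: dual_base center_dual_iff\<close>)
    then show ?thesis using \<phi> unfolding left_base_image right_base_image by (metis IntI imageI)
  qed
  have "\<phi> \<in> (\<lambda>x. left_translate A x \<one>\<^bsub>dual A\<^esub>) ` ?S" if "\<phi> \<in> C_L (dual A)" for \<phi>
  proof (rule image_eqI)
    have \<phi>: "\<phi> \<in> dual_set A" "\<phi> \<in> N_LL (dual A)" using that by (auto simp: C_L_def center_dual_iff)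
    show "\<phi> = left_translate A (base_L A \<phi>) \<one>\<^bsub>dual A\<^esub>"
    proof (rule dual_ext)
      fix a assume a: "a \<in> carrier A"
      \<comment> \<open>The \<open>N_LL\<close> condition with first argument \<open>\<one>\<close>
        reads \<open>\<phi>(a) = \<phi>(1\<^sub>1) \<epsilon>(1\<^sub>2 a)\<close>.\<close>
      have "\<phi> (\<one> \<cdot> a) = \<Delta> \<one> \<phi> (right_translate A a \<one>\<^bsub>dual A\<^esub>)"
        using \<phi>(2) a unit_closed unfolding N_dual_iff by blast
      with a \<phi>(1) show "\<phi> a = left_translate A (base_L A \<phi>) \<one>\<^bsub>dual A\<^esub> a"
        by (simp flip: dual_base(1))
    qed (use \<phi> in auto)
  qed (use that base in \<open>auto simp: C_L_def\<close>)
  moreover have "\<phi> \<in> (\<lambda>x. right_translate A x \<one>\<^bsub>dual A\<^esub>) ` ?S" if "\<phi> \<in> C_R (dual A)" for \<phi>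
  proof (rule image_eqI)
    have \<phi>: "\<phi> \<in> dual_set A" "\<phi> \<in> N_RL (dual A)" using that by (auto simp: C_R_def center_dual_iff)
    show "\<phi> = right_translate A (base_L A \<phi>) \<one>\<^bsub>dual A\<^esub>"
    proof (rule dual_ext)
      fix a assume a: "a \<in> carrier A"
      \<comment> \<open>The \<open>N_RL\<close> condition with second argument \<open>\<one>\<close>
        reads \<open>\<phi>(a) = \<phi>(1\<^sub>1) \<epsilon>(a 1\<^sub>2)\<close>.\<close>
      have "\<phi> (a \<cdot> \<one>) = \<Delta> \<one> \<phi> (left_translate A a \<one>\<^bsub>dual A\<^esub>)"
        using \<phi>(2) a unit_closed unfolding N_dual_iff by blast
      with a \<phi>(1) show "\<phi> a = right_translate A (base_L A \<phi>) \<one>\<^bsub>dual A\<^esub> a"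
        by (simp flip: dual_base(1))
    qed (use \<phi> in auto)
  qed (use that base in \<open>auto simp: C_R_def\<close>)
  ultimately show "bij_betw (\<lambda>x. left_translate A x \<one>\<^bsub>dual A\<^esub>) ?S (C_L (dual A))"
    "bij_betw (\<lambda>x. right_translate A x \<one>\<^bsub>dual A\<^esub>) ?S (C_R (dual A))"
    using inj into unfolding bij_betw_def by blast+
qed

lemma base_Int_iso_C_dual:
  "algebras_iso A (left_base A \<inter> right_base A) (dual A) (C_L (dual A))"
  "algebras_iso A (left_base A \<inter> right_base A) (dual A) (C_R (dual A))"
proof -
  let ?S = "left_base A \<inter> right_base A"
  have S: "subalgebra A ?S"
    using subalgebra_N comonoidal_bases(1,3)[OF com] by (simp add: subalgebra_Int module_axioms)
  have md: "module (smul (dual A))"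
    using vector_space_fun by (simp add: module_iff_vector_space)
  have eps: "\<one>\<^bsub>dual A\<^esub> (x + y) = \<one>\<^bsub>dual A\<^esub> x + \<one>\<^bsub>dual A\<^esub> y" "\<one>\<^bsub>dual A\<^esub> (c \<bullet> x) = c * \<one>\<^bsub>dual A\<^esub> x"
    if "x \<in> carrier A" "y \<in> carrier A" for c x y
    using dual_unit_closed that by (simp_all add: dual_set_def)
  have mul: "(x + y) \<cdot> z = x \<cdot> z + y \<cdot> z" "(c \<bullet> x) \<cdot> z = c \<bullet> (x \<cdot> z)"
    "z \<cdot> (x + y) = z \<cdot> x + z \<cdot> y" "z \<cdot> (c \<bullet> x) = c \<bullet> (z \<cdot> x)"
    if "x \<in> carrier A" "y \<in> carrier A" "z \<in> carrier A" for c x y z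
    using mul_linear_left[of z] mul_linear_right[of z] that by (auto simp: linear_map_on_def)
  note [simp] = base_Int_N(1)
  show "algebras_iso A ?S (dual A) (C_L (dual A))"
  proof (rule algebras_isoI[OF module_axioms md S translate_bij_C_dual(1)])
    show "C_L (dual A) \<subseteq> carrier (dual A)" by (auto simp: C_L_def N_dual_iff)
    show "left_translate A \<one> \<one>\<^bsub>dual A\<^esub> = \<one>\<^bsub>dual A\<^esub>" by (rule dual_ext) auto
    fix x y c assume x: "x \<in> ?S"
    show "left_translate A (c \<bullet> x) \<one>\<^bsub>dual A\<^esub> = c \<bullet>\<^bsub>dual A\<^esub> left_translate A x \<one>\<^bsub>dual A\<^esub>"
      using x by (auto simp: left_translate_def fun_eq_iff mul eps)
    assume y: "y \<in> ?S"
    show "left_translate A (x + y) \<one>\<^bsub>dual A\<^esub> = left_translate A x \<one>\<^bsub>dual A\<^esub> + left_translate A y \<one>\<^bsub>dual A\<^esub>"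
      using x y by (auto simp: left_translate_def fun_eq_iff mul eps)
    \<comment> \<open>Contracting the second leg sends \<open>a\<close> to
      \<open>\<epsilon>(x (y a))\<close>, with the factors in the required order.\<close>
    show "left_translate A (x \<cdot> y) \<one>\<^bsub>dual A\<^esub> = left_translate A x \<one>\<^bsub>dual A\<^esub> \<cdot>\<^bsub>dual A\<^esub> left_translate A y \<one>\<^bsub>dual A\<^esub>"
      using x y
      by (intro dual_ext) (simp_all add: dual_mul_apply comul_translate_counit(2) mul_assoc)
  qed
  show "algebras_iso A ?S (dual A) (C_R (dual A))"
  proof (rule algebras_isoI[OF module_axioms md S translate_bij_C_dual(2)])
    show "C_R (dual A) \<subseteq> carrier (dual A)" by (auto simp: C_R_def N_dual_iff)
    show "right_translate A \<one> \<one>\<^bsub>dual A\<^esub> = \<one>\<^bsub>dual A\<^esub>" by (rule dual_ext) auto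
    fix x y c assume x: "x \<in> ?S"
    show "right_translate A (c \<bullet> x) \<one>\<^bsub>dual A\<^esub> = c \<bullet>\<^bsub>dual A\<^esub> right_translate A x \<one>\<^bsub>dual A\<^esub>"
      using x by (auto simp: right_translate_def fun_eq_iff mul eps)
    assume y: "y \<in> ?S"
    show "right_translate A (x + y) \<one>\<^bsub>dual A\<^esub> = right_translate A x \<one>\<^bsub>dual A\<^esub> + right_translate A y \<one>\<^bsub>dual A\<^esub>"
      using x y by (auto simp: right_translate_def fun_eq_iff mul eps)
    \<comment> \<open>Here the first leg is contracted, giving \<open>\<epsilon>((a x) y)\<close>;
      this choice of leg again keeps the order of \<open>x\<close> and \<open>y\<close>.\<close>
    show "right_translate A (x \<cdot> y) \<one>\<^bsub>dual A\<^esub> = right_translate A x \<one>\<^bsub>dual A\<^esub> \<cdot>\<^bsub>dual A\<^esub> right_translate A y \<one>\<^bsub>dual A\<^esub>"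
      using x y by (intro dual_ext) (simp_all add: dual_mul_apply comul_translate_counit(3) mul_assoc)
  qed
qed

end

end

theorem corollary3p7:
  fixes A :: "('k::field, 'a::ab_group_add) bialg"
  assumes "weak_bialgebra A"
  shows "(comonoidal A \<longleftrightarrow> left_comonoidal A \<and> commuting A (left_base A) (right_base A))
    \<and> (comonoidal A \<longleftrightarrow> right_comonoidal A \<and> commuting A (left_base A) (right_base A))
    \<and> (comonoidal A \<longrightarrow>
        algebras_iso A (left_base A \<inter> right_base A) (dual A) (C_L (dual A))
        \<and> algebras_iso (dual A) (C_L (dual A)) (dual A) (C_R (dual A))
        \<and> C_L A = center A \<inter> left_base A
        \<and> C_R A = center A \<inter> right_base A)"
proof -
  interpret weak_bialgebra A by (rule assms)
  \<comment> \<open>The isomorphism is the composite through the intersection of the two bases,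
    which is isomorphic to both algebras.\<close>
  have "algebras_iso (dual A) (C_L (dual A)) (dual A) (C_R (dual A))" if "comonoidal A"
    using algebras_iso_trans[OF algebras_iso_sym[OF module_axioms]] base_Int_iso_C_dual[OF that] .
  then show ?thesis
    using comonoidal_equivalences C_eq_center_base base_Int_iso_C_dual(1) by (intro conjI impI) auto
qed

end
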